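(* Let $H$ be a Hopf algebra over $\mathbb{C}$ with invertible antipode and let $C$ be a left $H$-module coalgebra. Then every ${}_CH$-SAYD module $M$ is a ${}_CH$-HCC; that is, the operators $\partial_i,\sigma_i,\tau_n$ given in the context are well defined on the spaces $C^n_H(C,M)=M\otimes_H C^{\otimes(n+1)}$, $n\ge 0$, and turn $C^*_H(C,M)$ into a cocyclic module.
   Context: Work over $\mathbb{C}$. All Hopf algebras have invertible antipode $S$; $\varepsilon$ denotes counits. Sweedler notation: $\Delta(h)=h^{(1)}\otimes h^{(2)}$ and similarly for iterated coproducts and for coproducts of $C$; left coactions are written $m\mapsto m_{\langle -1\rangle}\otimes m_{\langle 0\rangle}$. A left $H$-module coalgebra is a coalgebra $C$ with a left $H$-action such that $\Delta(hc)=h^{(1)}c^{(1)}\otimes h^{(2)}c^{(2)}$ and $\varepsilon(hc)=\varepsilon(h)\varepsilon(c)$. $H$ acts diagonally on $C^{\otimes n}$. A right-left module-comodule over $H$ is a vector space $M$ that is a right $H$-module and a left $H$-comodule (no compatibility is assumed). ${}_CH$-SAYD module: a right-left module-comodule $M$ over $H$ such that for all $m\in M$, $h\in H$, $c\in C$ and $\tilde d\in C^{\otimes n}$ ($n\ge 1$): (${}_CH$-AYD) $(mh)_{\langle -1\rangle}c\otimes (mh)_{\langle 0\rangle}=S(h^{(3)})m_{\langle -1\rangle}h^{(1)}c\otimes m_{\langle 0\rangle}h^{(2)}$ in $C\otimes M$; (${}_CH$-stability) $m_{\langle 0\rangle}\otimes_H m_{\langle -1\rangle}\tilde d=m\otimes_H\tilde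 d$ in $M\otimes_H C^{\otimes n}$. Operators. For a right-left module-comodule $M$, define on $C^n(C,M)=M\otimes C^{\otimes(n+1)}$: $\partial_i(m\otimes c_0\otimes\dots\otimes c_n)=m\otimes c_0\otimes\dots\otimes c_i^{(1)}\otimes c_i^{(2)}\otimes\dots\otimes c_n$ for $0\le i\le n$; $\partial_{n+1}(m\otimes c_0\otimes\dots\otimes c_n)=m_{\langle 0\rangle}\otimes c_0^{(2)}\otimes c_1\otimes\dots\otimes c_n\otimes m_{\langle -1\rangle}c_0^{(1)}$; $\sigma_i(m\otimes c_0\otimes\dots\otimes c_n)=m\otimes c_0\otimes\dots\otimes\varepsilon(c_{i+1})\otimes\dots\otimes c_n$ for $0\le i\le n-1$; $\tau_n(m\otimes c_0\otimes\dots\otimes c_n)=m_{\langle 0\rangle}\otimes c_1\otimes\dots\otimes c_n\otimes m_{\langle -1\rangle}c_0$. "Well defined on $C^n_H(C,M)$" means that these operators descend to the quotients $M\otimes_H C^{\otimes(n+1)}$ of $M\otimes C^{\otimes(n+1)}$. A cocyclic module is a cosimplicial module with operators $\tau_n$ satisfying $\tau_n\partial_i=\partial_{i-1}\tau_{n-1}$ ($1\le i\le n$), $\tau_n\partial_0=\partial_n$, $\tau_n\sigma_i=\sigma_{i-1}\tau_{n+1}$ ($1\le i\le n$), $\tau_n\sigma_0=\sigma_n\tau_{n+1}^2$, and $\tau_n^{n+1}=\mathrm{Id}$. *)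

theory Defs
  imports Complex_Main "HOL-Library.Poly_Mapping" "HOL-Algebra.Module"
    "HOL-Algebra.Algebraic_Closure_Type"
begin

section \<open>Complex vector spaces\<close>

class scaleC =
  fixes scaleC :: "complex \<Rightarrow> 'a \<Rightarrow> 'a" (infixr \<open>*\<^sub>C\<close> 75)

class complex_vector = ab_group_add + scaleC +
  assumes scaleC_add_right: "a *\<^sub>C (x + y) = a *\<^sub>C x + a *\<^sub>C y"
    and scaleC_add_left: "(a + b) *\<^sub>C x = a *\<^sub>C x + b *\<^sub>C x"
    and scaleC_scaleC: "a *\<^sub>C (b *\<^sub>C x) = (a * b) *\<^sub>C x"
    and scaleC_one: "1 *\<^sub>C x = x"

global_interpretation complex_vector:
  vector_space "scaleC :: complex \<Rightarrow> 'a \<Rightarrow> 'a::complex_vector"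
  by unfold_locales
    (rule scaleC_add_right scaleC_add_left scaleC_scaleC scaleC_one)+

abbreviation clinear :: "('a::complex_vector \<Rightarrow> 'b::complex_vector) \<Rightarrow> bool"
  where "clinear \<equiv> Vector_Spaces.linear scaleC scaleC"

lemma clinearI:
  fixes f :: "'a::complex_vector \<Rightarrow> 'b::complex_vector"
  assumes "\<And>x y. f (x + y) = f x + f y" and "\<And>r x. f (r *\<^sub>C x) = r *\<^sub>C f x"
  shows "clinear f"
  using assms by unfold_locales auto

definition cbilinear ::
    "('a::complex_vector \<Rightarrow> 'b::complex_vector \<Rightarrow> 'c::complex_vector) \<Rightarrow> bool"
  where "cbilinear f \<longleftrightarrow> (\<forall>a. clinear (f a)) \<and> (\<forall>b. clinear (\<lambda>a. f a b))"

definition multilinear :: "('a::complex_vector list \<Rightarrow> 'b::complex_vector) \<Rightarrow> bool"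
  where "multilinear f \<longleftrightarrow> (\<forall>xs ys. clinear (\<lambda>a. f (xs @ a # ys)))"

instantiation complex :: complex_vector
begin

definition scaleC_complex :: "complex \<Rightarrow> complex \<Rightarrow> complex"
  where "scaleC_complex = (*)"

instance
  by standard (simp_all add: scaleC_complex_def algebra_simps)

end

instantiation poly_mapping :: (type, complex_vector) complex_vector
begin

lift_definition scaleC_poly_mapping :: "complex \<Rightarrow> ('a \<Rightarrow>\<^sub>0 'b) \<Rightarrow> ('a \<Rightarrow>\<^sub>0 'b)"
  is "\<lambda>r f k. r *\<^sub>C f k"
proof -
  fix r :: complex and f :: "'a \<Rightarrow> 'b"
  assume "finite {k. f k \<noteq> 0}"
  then show "finite {k. r *\<^sub>C f k \<noteq> 0}"
    by (rule rev_finite_subset) auto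
qed

instance
  by (standard; transfer) (simp_all add: fun_eq_iff scaleC_add_right scaleC_add_left
      scaleC_scaleC scaleC_one)

end


section \<open>Tensor products\<close>

text \<open>Finitely supported functions \<open>'k \<Rightarrow>\<^sub>0 complex\<close> form the free vector space on \<open>'k\<close>.\<close>

definition gen :: "'k \<Rightarrow> ('k \<Rightarrow>\<^sub>0 complex)"
  where "gen k = Poly_Mapping.single k 1"

definition free_lift :: "('k \<Rightarrow> 'v::complex_vector) \<Rightarrow> ('k \<Rightarrow>\<^sub>0 complex) \<Rightarrow> 'v"
  where "free_lift f p = (\<Sum>k\<in>Poly_Mapping.keys p. Poly_Mapping.lookup p k *\<^sub>C f k)"

lemma free_lift_superset:
  assumes "finite A" "Poly_Mapping.keys p \<subseteq> A"
  shows "free_lift f p = (\<Sum>k\<in>A. Poly_Mapping.lookup p k *\<^sub>C f k)"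
  unfolding free_lift_def
  by (rule sum.mono_neutral_left) (use assms in \<open>auto simp: in_keys_iff\<close>)

lemma lookup_scaleC: "Poly_Mapping.lookup (r *\<^sub>C p) k = r *\<^sub>C Poly_Mapping.lookup p k"
  by transfer simp

lemma clinear_free_lift: "clinear (free_lift f)"
proof (rule clinearI)
  fix p q :: "'a \<Rightarrow>\<^sub>0 complex" and r :: complex
  let ?A = "Poly_Mapping.keys p \<union> Poly_Mapping.keys q"
  have "free_lift f (p + q) = (\<Sum>k\<in>?A. Poly_Mapping.lookup (p + q) k *\<^sub>C f k)"
    by (rule free_lift_superset) (auto simp: Poly_Mapping.keys_add)
  also have "\<dots> = (\<Sum>k\<in>?A. Poly_Mapping.lookup p k *\<^sub>C f k)
      + (\<Sum>k\<in>?A. Poly_Mapping.lookup q k *\<^sub>C f k)"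
    by (simp add: lookup_add scaleC_add_left sum.distrib)
  also have "\<dots> = free_lift f p + free_lift f q"
    by (simp add: free_lift_superset[of ?A])
  finally show "free_lift f (p + q) = free_lift f p + free_lift f q" .
  have "free_lift f (r *\<^sub>C p)
      = (\<Sum>k\<in>Poly_Mapping.keys p. Poly_Mapping.lookup (r *\<^sub>C p) k *\<^sub>C f k)"
    by (rule free_lift_superset)
      (auto simp: in_keys_iff lookup_scaleC scaleC_complex_def)
  then show "free_lift f (r *\<^sub>C p) = r *\<^sub>C free_lift f p"
    by (simp add: free_lift_def lookup_scaleC scaleC_complex_def
        complex_vector.scale_sum_right)
qed

lemma free_lift_gen [simp]: "free_lift f (gen k) = f k"
  by (simp add: free_lift_def gen_def)

lemma clinear_eq_on_quotient:
  assumes "clinear g" and "\<And>r. r \<in> R \<Longrightarrow> g r = 0"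
    and "x - y \<in> complex_vector.span R"
  shows "g x = g y"
proof -
  interpret Vector_Spaces.linear scaleC scaleC g by fact
  have "g (x - y) = 0"
    using eq_0_on_span[of R "x - y"] assms by auto
  then show ?thesis by (simp add: diff)
qed

definition tensor_relators :: "('a::complex_vector \<times> 'b::complex_vector \<Rightarrow>\<^sub>0 complex) set"
  where "tensor_relators =
      {gen (a + a', b) - gen (a, b) - gen (a', b) | a a' b. True}
    \<union> {gen (a, b + b') - gen (a, b) - gen (a, b') | a b b'. True}
    \<union> {gen (r *\<^sub>C a, b) - r *\<^sub>C gen (a, b) | r a b. True}
    \<union> {gen (a, r *\<^sub>C b) - r *\<^sub>C gen (a, b) | r a b. True}"

definition tensor_eq ::
    "('a::complex_vector \<times> 'b::complex_vector \<Rightarrow>\<^sub>0 complex) \<Rightarrow> ('a \<times> 'b \<Rightarrow>\<^sub>0 complex) \<Rightarrow> bool"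
  where "tensor_eq p q \<longleftrightarrow> p - q \<in> complex_vector.span tensor_relators"

lemma equivp_span_diff: "equivp (\<lambda>p q. p - q \<in> complex_vector.span R)"
proof (rule equivpI)
  show "reflp (\<lambda>p q. p - q \<in> complex_vector.span R)"
    by (rule reflpI) (simp add: complex_vector.span_zero)
  show "symp (\<lambda>p q. p - q \<in> complex_vector.span R)"
    by (rule sympI) (metis complex_vector.span_neg minus_diff_eq)
  show "transp (\<lambda>p q. p - q \<in> complex_vector.span R)"
  proof (rule transpI)
    fix p q r assume "p - q \<in> complex_vector.span R" "q - r \<in> complex_vector.span R"
    from complex_vector.span_add[OF this] show "p - r \<in> complex_vector.span R" by simp
  qed
qed

lemma span_diff_add:
  "p - q \<in> complex_vector.span R \<Longrightarrow> p' - q' \<in> complex_vector.span R \<Longrightarrow>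
    (p + p') - (q + q') \<in> complex_vector.span R"
  using complex_vector.span_add[of "p - q" R "p' - q'"] by (simp add: algebra_simps)

lemma span_diff_diff:
  "p - q \<in> complex_vector.span R \<Longrightarrow> p' - q' \<in> complex_vector.span R \<Longrightarrow>
    (p - p') - (q - q') \<in> complex_vector.span R"
  using complex_vector.span_diff[of "p - q" R "p' - q'"] by (simp add: algebra_simps)

lemma span_diff_uminus:
  "p - q \<in> complex_vector.span R \<Longrightarrow> (- p) - (- q) \<in> complex_vector.span R"
  using complex_vector.span_neg[of "p - q" R] by (simp add: algebra_simps)

lemma span_diff_scale:
  "p - q \<in> complex_vector.span R \<Longrightarrow> (r *\<^sub>C p) - (r *\<^sub>C q) \<in> complex_vector.span R"
  using complex_vector.span_scale[of "p - q" R r]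
  by (simp add: complex_vector.scale_right_diff_distrib)

quotient_type (overloaded) ('a, 'b) tensor =
    "'a::complex_vector \<times> 'b::complex_vector \<Rightarrow>\<^sub>0 complex" / tensor_eq
  unfolding tensor_eq_def by (rule equivp_span_diff)

instantiation tensor :: (complex_vector, complex_vector) complex_vector
begin

lift_definition zero_tensor :: "('a, 'b) tensor" is 0 .

lift_definition plus_tensor :: "('a, 'b) tensor \<Rightarrow> ('a, 'b) tensor \<Rightarrow> ('a, 'b) tensor" is "(+)"
  unfolding tensor_eq_def by (rule span_diff_add)

lift_definition minus_tensor :: "('a, 'b) tensor \<Rightarrow> ('a, 'b) tensor \<Rightarrow> ('a, 'b) tensor" is "(-)"
  unfolding tensor_eq_def by (rule span_diff_diff)

lift_definition uminus_tensor :: "('a, 'b) tensor \<Rightarrow> ('a, 'b) tensor" is "uminus"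
  unfolding tensor_eq_def by (rule span_diff_uminus)

lift_definition scaleC_tensor :: "complex \<Rightarrow> ('a, 'b) tensor \<Rightarrow> ('a, 'b) tensor" is "scaleC"
  unfolding tensor_eq_def by (rule span_diff_scale)

instance
  by (standard; transfer) (simp_all add: tensor_eq_def complex_vector.span_zero algebra_simps
      scaleC_add_right scaleC_add_left scaleC_scaleC scaleC_one)

end

lift_definition tensor :: "'a::complex_vector \<Rightarrow> 'b::complex_vector \<Rightarrow> ('a, 'b) tensor"
    (infixr \<open>\<otimes>\<^sub>C\<close> 72)
  is "\<lambda>a b. gen (a, b)" .

text \<open>
  The linear map induced on the tensor product by a bilinear \<open>f\<close>. In Sweedler notation,
  \<open>tlift (\<lambda>x y. f x y) (\<Delta> h)\<close> is \<open>f h\<^sup>(\<^sup>1\<^sup>) h\<^sup>(\<^sup>2\<^sup>)\<close>. The value is meaningful only for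
  bilinear \<open>f\<close>, since a representative of the tensor is chosen.
\<close>

definition tlift ::
    "('a::complex_vector \<Rightarrow> 'b::complex_vector \<Rightarrow> 'v::complex_vector) \<Rightarrow> ('a, 'b) tensor \<Rightarrow> 'v"
  where "tlift f t = free_lift (\<lambda>(a, b). f a b) (rep_tensor t)"

lemma cbilinear_tensor: "cbilinear (\<otimes>\<^sub>C)"
  unfolding cbilinear_def
proof (intro conjI allI; rule clinearI)
  fix a a' :: 'a and b b' :: 'b and r :: complex
  show "a \<otimes>\<^sub>C (b + b') = a \<otimes>\<^sub>C b + a \<otimes>\<^sub>C b'"
    by transfer (unfold tensor_eq_def tensor_relators_def diff_diff_eq[symmetric],
        rule complex_vector.span_base, blast)
  show "(a + a') \<otimes>\<^sub>C b = a \<otimes>\<^sub>C b + a' \<otimes>\<^sub>C b"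
    by transfer (unfold tensor_eq_def tensor_relators_def diff_diff_eq[symmetric],
        rule complex_vector.span_base, blast)
  show "a \<otimes>\<^sub>C (r *\<^sub>C b) = r *\<^sub>C (a \<otimes>\<^sub>C b)"
    by transfer (unfold tensor_eq_def tensor_relators_def, rule complex_vector.span_base, blast)
  show "(r *\<^sub>C a) \<otimes>\<^sub>C b = r *\<^sub>C (a \<otimes>\<^sub>C b)"
    by transfer (unfold tensor_eq_def tensor_relators_def, rule complex_vector.span_base, blast)
qed

lemma free_lift_tensor_eq:
  assumes "cbilinear f" and "tensor_eq p q"
  shows "free_lift (\<lambda>(a, b). f a b) p = free_lift (\<lambda>(a, b). f a b) q"
proof (rule clinear_eq_on_quotient[OF clinear_free_lift, where R = tensor_relators])
  let ?L = "free_lift (\<lambda>(a, b). f a b)"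
  interpret L: Vector_Spaces.linear scaleC scaleC ?L by (rule clinear_free_lift)
  have lin: "clinear (f a)" "clinear (\<lambda>a. f a b)" for a b
    using assms(1) by (auto simp: cbilinear_def)
  show "?L r = 0" if "r \<in> tensor_relators" for r
    using that unfolding tensor_relators_def
    by (auto simp: L.diff L.scale lin[THEN module_hom.add[OF Vector_Spaces.linear.axioms(3)]]
        lin[THEN module_hom.scale[OF Vector_Spaces.linear.axioms(3)]])
  show "p - q \<in> complex_vector.span tensor_relators"
    using assms(2) by (simp add: tensor_eq_def)
qed

lemma tlift_abs:
  assumes "cbilinear f"
  shows "tlift f (abs_tensor p) = free_lift (\<lambda>(a, b). f a b) p"
  unfolding tlift_def
  by (intro free_lift_tensor_eq[OF assms]
      Quotient3_rep_abs[OF Quotient3_tensor] ) (simp add: tensor_eq_def complex_vector.span_zero)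

lemma tlift_tensor:
  assumes "cbilinear f"
  shows "tlift f (a \<otimes>\<^sub>C b) = f a b"
  by (simp add: tensor.abs_eq tlift_abs[OF assms])

lemma clinear_tlift:
  assumes "cbilinear f"
  shows "clinear (tlift f)"
proof (rule clinearI)
  interpret L: Vector_Spaces.linear scaleC scaleC "free_lift (\<lambda>(a, b). f a b)"
    by (rule clinear_free_lift)
  fix s t :: "('a, 'b) tensor" and r :: complex
  obtain p q where *: "s = abs_tensor p" "t = abs_tensor q"
    by (metis Quotient3_abs_rep[OF Quotient3_tensor])
  show "tlift f (s + t) = tlift f s + tlift f t"
    by (simp add: * plus_tensor.abs_eq tlift_abs[OF assms] L.add)
  show "tlift f (r *\<^sub>C s) = r *\<^sub>C tlift f s"
    by (simp add: * scaleC_tensor.abs_eq tlift_abs[OF assms] L.scale)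
qed

text \<open>
  \<open>'a tpow\<close> is the underlying vector space of the tensor algebra, i.e. the direct sum of all
  \<open>'a\<^sup>\<otimes>\<^sup>n\<close>, with \<open>tp [a\<^sub>1, \<dots>, a\<^sub>n]\<close> standing for \<open>a\<^sub>1 \<otimes> \<dots> \<otimes> a\<^sub>n\<close>; the relators are
  homogeneous, and \<open>tpow_space n\<close> is the \<open>n\<close>-th tensor power.
\<close>

definition tpow_relators :: "('a::complex_vector list \<Rightarrow>\<^sub>0 complex) set"
  where "tpow_relators =
      {gen (xs @ (a + b) # ys) - gen (xs @ a # ys) - gen (xs @ b # ys) | xs a b ys. True}
    \<union> {gen (xs @ (r *\<^sub>C a) # ys) - r *\<^sub>C gen (xs @ a # ys) | xs r a ys. True}"

definition tpow_eq ::
    "('a::complex_vector list \<Rightarrow>\<^sub>0 complex) \<Rightarrow> ('a list \<Rightarrow>\<^sub>0 complex) \<Rightarrow> bool"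
  where "tpow_eq p q \<longleftrightarrow> p - q \<in> complex_vector.span tpow_relators"

quotient_type (overloaded) 'a tpow = "'a::complex_vector list \<Rightarrow>\<^sub>0 complex" / tpow_eq
  unfolding tpow_eq_def by (rule equivp_span_diff)

instantiation tpow :: (complex_vector) complex_vector
begin

lift_definition zero_tpow :: "'a tpow" is 0 .

lift_definition plus_tpow :: "'a tpow \<Rightarrow> 'a tpow \<Rightarrow> 'a tpow" is "(+)"
  unfolding tpow_eq_def by (rule span_diff_add)

lift_definition minus_tpow :: "'a tpow \<Rightarrow> 'a tpow \<Rightarrow> 'a tpow" is "(-)"
  unfolding tpow_eq_def by (rule span_diff_diff)

lift_definition uminus_tpow :: "'a tpow \<Rightarrow> 'a tpow" is "uminus"
  unfolding tpow_eq_def by (rule span_diff_uminus)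

lift_definition scaleC_tpow :: "complex \<Rightarrow> 'a tpow \<Rightarrow> 'a tpow" is "scaleC"
  unfolding tpow_eq_def by (rule span_diff_scale)

instance
  by (standard; transfer) (simp_all add: tpow_eq_def complex_vector.span_zero algebra_simps
      scaleC_add_right scaleC_add_left scaleC_scaleC scaleC_one)

end

lift_definition tp :: "'a::complex_vector list \<Rightarrow> 'a tpow" is gen .

definition tpow_space :: "nat \<Rightarrow> 'a::complex_vector tpow set"
  where "tpow_space n = complex_vector.span {tp xs | xs. length xs = n}"

text \<open>
  The linear map induced by an \<open>f\<close> that is multilinear on lists of each length; as with
  \<^const>\<open>tlift\<close>, only multilinear \<open>f\<close> are meaningful.
\<close>

definition tpow_lift :: "('a::complex_vector list \<Rightarrow> 'v::complex_vector) \<Rightarrow> 'a tpow \<Rightarrow> 'v"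
  where "tpow_lift f t = free_lift f (rep_tpow t)"

lemma multilinear_tp: "multilinear tp"
  unfolding multilinear_def
proof (intro allI; rule clinearI)
  fix xs ys :: "'a list" and a b :: 'a and r :: complex
  show "tp (xs @ (a + b) # ys) = tp (xs @ a # ys) + tp (xs @ b # ys)"
    by transfer (unfold tpow_eq_def tpow_relators_def diff_diff_eq[symmetric],
        rule complex_vector.span_base, blast)
  show "tp (xs @ (r *\<^sub>C a) # ys) = r *\<^sub>C tp (xs @ a # ys)"
    by transfer (unfold tpow_eq_def tpow_relators_def, rule complex_vector.span_base, blast)
qed

lemma free_lift_tpow_eq:
  assumes "multilinear f" and "tpow_eq p q"
  shows "free_lift f p = free_lift f q"
proof (rule clinear_eq_on_quotient[OF clinear_free_lift, where R = tpow_relators])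
  interpret L: Vector_Spaces.linear scaleC scaleC "free_lift f" by (rule clinear_free_lift)
  have lin: "clinear (\<lambda>a. f (xs @ a # ys))" for xs ys
    using assms(1) by (auto simp: multilinear_def)
  show "free_lift f r = 0" if "r \<in> tpow_relators" for r
    using that unfolding tpow_relators_def
    by (auto simp: L.diff L.scale lin[THEN module_hom.add[OF Vector_Spaces.linear.axioms(3)]]
        lin[THEN module_hom.scale[OF Vector_Spaces.linear.axioms(3)]])
  show "p - q \<in> complex_vector.span tpow_relators"
    using assms(2) by (simp add: tpow_eq_def)
qed

lemma tpow_lift_abs:
  assumes "multilinear f"
  shows "tpow_lift f (abs_tpow p) = free_lift f p"
  unfolding tpow_lift_def
  by (intro free_lift_tpow_eq[OF assms]
      Quotient3_rep_abs[OF Quotient3_tpow]) (simp add: tpow_eq_def complex_vector.span_zero)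

lemma tpow_lift_tp:
  assumes "multilinear f"
  shows "tpow_lift f (tp xs) = f xs"
  by (simp add: tp.abs_eq tpow_lift_abs[OF assms])

lemma clinear_tpow_lift:
  assumes "multilinear f"
  shows "clinear (tpow_lift f)"
proof (rule clinearI)
  interpret L: Vector_Spaces.linear scaleC scaleC "free_lift f"
    by (rule clinear_free_lift)
  fix s t :: "'a tpow" and r :: complex
  obtain p q where *: "s = abs_tpow p" "t = abs_tpow q"
    by (metis Quotient3_abs_rep[OF Quotient3_tpow])
  show "tpow_lift f (s + t) = tpow_lift f s + tpow_lift f t"
    by (simp add: * plus_tpow.abs_eq tpow_lift_abs[OF assms] L.add)
  show "tpow_lift f (r *\<^sub>C s) = r *\<^sub>C tpow_lift f s"
    by (simp add: * scaleC_tpow.abs_eq tpow_lift_abs[OF assms] L.scale)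
qed


section \<open>Hopf algebras, module coalgebras and module-comodules\<close>

record (overloaded) 'a coalg =
  comult :: "'a \<Rightarrow> ('a, 'a) tensor"
  counit :: "'a \<Rightarrow> complex"

record (overloaded) 'h hopf = "'h coalg" +
  times_of :: "'h \<Rightarrow> 'h \<Rightarrow> 'h"
  unit_of :: 'h
  antipode :: "'h \<Rightarrow> 'h"

record (overloaded) ('h, 'c) module_coalg = "'c coalg" +
  lact :: "'h \<Rightarrow> 'c \<Rightarrow> 'c"

record (overloaded) ('h, 'm) modcomod =
  ract :: "'m \<Rightarrow> 'h \<Rightarrow> 'm"
  coact :: "'m \<Rightarrow> ('h, 'm) tensor"

definition coalgebra :: "('a::complex_vector, 'e) coalg_scheme \<Rightarrow> bool"
  where "coalgebra C \<longleftrightarrow>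
    clinear (comult C) \<and> clinear (counit C) \<and>
    (\<forall>c. tlift (\<lambda>x y. tlift (\<lambda>u v. u \<otimes>\<^sub>C v \<otimes>\<^sub>C y) (comult C x)) (comult C c)
       = tlift (\<lambda>x y. x \<otimes>\<^sub>C comult C y) (comult C c)) \<and>
    (\<forall>c. tlift (\<lambda>x y. counit C x *\<^sub>C y) (comult C c) = c) \<and>
    (\<forall>c. tlift (\<lambda>x y. counit C y *\<^sub>C x) (comult C c) = c)"

definition hopf_algebra :: "'h::complex_vector hopf \<Rightarrow> bool"
  where "hopf_algebra H \<longleftrightarrow>
    cbilinear (times_of H) \<and>
    (\<forall>a b c. times_of H (times_of H a b) c = times_of H a (times_of H b c)) \<and>
    (\<forall>a. times_of H (unit_of H) a = a) \<and>
    (\<forall>a. times_of H a (unit_of H) = a) \<and>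
    coalgebra H \<and>
    (\<forall>a b. comult H (times_of H a b) =
      tlift (\<lambda>a1 a2. tlift (\<lambda>b1 b2. times_of H a1 b1 \<otimes>\<^sub>C times_of H a2 b2) (comult H b))
        (comult H a)) \<and>
    comult H (unit_of H) = unit_of H \<otimes>\<^sub>C unit_of H \<and>
    (\<forall>a b. counit H (times_of H a b) = counit H a * counit H b) \<and>
    counit H (unit_of H) = 1 \<and>
    clinear (antipode H) \<and>
    (\<forall>a. tlift (\<lambda>x y. times_of H (antipode H x) y) (comult H a) = counit H a *\<^sub>C unit_of H) \<and>
    (\<forall>a. tlift (\<lambda>x y. times_of H x (antipode H y)) (comult H a) = counit H a *\<^sub>C unit_of H)"

definition left_module_coalgebra ::
    "'h::complex_vector hopf \<Rightarrow> ('h, 'c::complex_vector) module_coalg \<Rightarrow> bool"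
  where "left_module_coalgebra H C \<longleftrightarrow>
    coalgebra C \<and>
    cbilinear (lact C) \<and>
    (\<forall>c. lact C (unit_of H) c = c) \<and>
    (\<forall>g h c. lact C (times_of H g h) c = lact C g (lact C h c)) \<and>
    (\<forall>h c. comult C (lact C h c) =
      tlift (\<lambda>h1 h2. tlift (\<lambda>c1 c2. lact C h1 c1 \<otimes>\<^sub>C lact C h2 c2) (comult C c))
        (comult H h)) \<and>
    (\<forall>h c. counit C (lact C h c) = counit H h * counit C c)"

definition right_left_module_comodule ::
    "'h::complex_vector hopf \<Rightarrow> ('h, 'm::complex_vector) modcomod \<Rightarrow> bool"
  where "right_left_module_comodule H M \<longleftrightarrow>
    cbilinear (ract M) \<and>
    (\<forall>m. ract M m (unit_of H) = m) \<and>
    (\<forall>m g h. ract M m (times_of H g h) = ract M (ract M m g) h) \<and>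
    clinear (coact M) \<and>
    (\<forall>m. tlift (\<lambda>x m'. tlift (\<lambda>u v. u \<otimes>\<^sub>C v \<otimes>\<^sub>C m') (comult H x)) (coact M m)
       = tlift (\<lambda>x m'. x \<otimes>\<^sub>C coact M m') (coact M m)) \<and>
    (\<forall>m. tlift (\<lambda>x m'. counit H x *\<^sub>C m') (coact M m) = m)"

text \<open>The diagonal action on pure tensors: \<open>h (c\<^sub>1 \<otimes> \<dots> \<otimes> c\<^sub>n) = h\<^sup>(\<^sup>1\<^sup>)c\<^sub>1 \<otimes> \<dots> \<otimes> h\<^sup>(\<^sup>n\<^sup>)c\<^sub>n\<close>.\<close>

primrec diag_list :: "'h::complex_vector hopf \<Rightarrow> ('h, 'c::complex_vector) module_coalg \<Rightarrow>
    'h \<Rightarrow> 'c list \<Rightarrow> 'c tpow"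
  where
    "diag_list H C h [] = counit H h *\<^sub>C tp []"
  | "diag_list H C h (c # cs) =
      tlift (\<lambda>h1 h2. tpow_lift (\<lambda>ds. tp (lact C h1 c # ds)) (diag_list H C h2 cs)) (comult H h)"

definition diag :: "'h::complex_vector hopf \<Rightarrow> ('h, 'c::complex_vector) module_coalg \<Rightarrow>
    'h \<Rightarrow> 'c tpow \<Rightarrow> 'c tpow"
  where "diag H C h = tpow_lift (diag_list H C h)"


section \<open>Quotient spaces\<close>

definition coset :: "'v::complex_vector set \<Rightarrow> 'v \<Rightarrow> 'v set"
  where "coset B x = {x + b | b. b \<in> B}"

text \<open>
  The quotient of a subspace \<open>A\<close> by a subspace \<open>B \<subseteq> A\<close>. The multiplicative fields that a
  module record inherits from rings play no role in \<^locale>\<open>module\<close>.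
\<close>

definition quotient_space ::
    "'v::complex_vector set \<Rightarrow> 'v set \<Rightarrow> (complex, 'v set) Module.module"
  where "quotient_space A B =
    \<lparr>carrier = coset B ` A, monoid.mult = undefined, one = undefined,
     ring.zero = B, add = (\<lambda>E F. {x + y | x y. x \<in> E \<and> y \<in> F}),
     module.smult = (\<lambda>a E. {a *\<^sub>C x + b | x b. x \<in> E \<and> b \<in> B})\<rparr>"

definition descends ::
    "'v::complex_vector set \<Rightarrow> 'v set \<Rightarrow> 'w::complex_vector set \<Rightarrow> 'w set \<Rightarrow> ('v \<Rightarrow> 'w) \<Rightarrow> bool"
  where "descends A B A' B' f \<longleftrightarrow>
    (\<forall>x\<in>A. f x \<in> A') \<and>
    (\<forall>x\<in>A. \<forall>y\<in>A. coset B x = coset B y \<longrightarrow> coset B' (f x) = coset B' (f y))"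

text \<open>If \<open>f\<close> descends, this sends the coset of \<open>x\<close> to the coset of \<open>f x\<close>.\<close>

definition induced :: "'w::complex_vector set \<Rightarrow> ('v \<Rightarrow> 'w) \<Rightarrow> 'v set \<Rightarrow> 'w set"
  where "induced B' f E = (\<Union>x\<in>E. coset B' (f x))"


section \<open>Cocyclic modules\<close>

definition module_map ::
    "('r, 'e) ring_scheme \<Rightarrow> ('r, 'v, 'f) module_scheme \<Rightarrow> ('r, 'w, 'g) module_scheme \<Rightarrow> ('v \<Rightarrow> 'w) \<Rightarrow> bool"
  where "module_map R E F f \<longleftrightarrow>
    f \<in> carrier E \<rightarrow> carrier F \<and>
    (\<forall>x\<in>carrier E. \<forall>y\<in>carrier E. f (x \<oplus>\<^bsub>E\<^esub> y) = f x \<oplus>\<^bsub>F\<^esub> f y) \<and>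
    (\<forall>a\<in>carrier R. \<forall>x\<in>carrier E. f (a \<odot>\<^bsub>E\<^esub> x) = a \<odot>\<^bsub>F\<^esub> f x)"

text \<open>
  The first index of every operator is the degree of its domain:
  \<open>\<delta> n i : E n \<rightarrow> E (n + 1)\<close> for \<open>i \<le> n + 1\<close>, \<open>\<sigma> n i : E n \<rightarrow> E (n - 1)\<close> for \<open>i < n\<close>, and
  \<open>\<tau> n : E n \<rightarrow> E n\<close>.
\<close>

locale cosimplicial_module =
  fixes R :: "('r, 'e) ring_scheme"
    and E :: "nat \<Rightarrow> ('r, 'v, 'f) module_scheme"
    and \<delta> :: "nat \<Rightarrow> nat \<Rightarrow> 'v \<Rightarrow> 'v"
    and \<sigma> :: "nat \<Rightarrow> nat \<Rightarrow> 'v \<Rightarrow> 'v"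
  assumes module: "Module.module R (E n)"
    and coface_map: "i \<le> n + 1 \<Longrightarrow> module_map R (E n) (E (n + 1)) (\<delta> n i)"
    and codegeneracy_map: "i < n \<Longrightarrow> module_map R (E n) (E (n - 1)) (\<sigma> n i)"
    and coface_coface:
      "\<lbrakk>i < j; j \<le> n + 2; x \<in> carrier (E n)\<rbrakk> \<Longrightarrow>
        \<delta> (n + 1) j (\<delta> n i x) = \<delta> (n + 1) i (\<delta> n (j - 1) x)"
    and codegeneracy_codegeneracy:
      "\<lbrakk>i \<le> j; j \<le> n; x \<in> carrier (E (n + 2))\<rbrakk> \<Longrightarrow>
        \<sigma> (n + 1) j (\<sigma> (n + 2) i x) = \<sigma> (n + 1) i (\<sigma> (n + 2) (j + 1) x)"
    and codegeneracy_coface_less: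
      "\<lbrakk>i < j; j \<le> n; x \<in> carrier (E n)\<rbrakk> \<Longrightarrow>
        \<sigma> (n + 1) j (\<delta> n i x) = \<delta> (n - 1) i (\<sigma> n (j - 1) x)"
    and codegeneracy_coface_same:
      "\<lbrakk>i = j \<or> i = j + 1; j \<le> n; x \<in> carrier (E n)\<rbrakk> \<Longrightarrow> \<sigma> (n + 1) j (\<delta> n i x) = x"
    and codegeneracy_coface_greater:
      "\<lbrakk>j + 1 < i; i \<le> n + 1; x \<in> carrier (E n)\<rbrakk> \<Longrightarrow>
        \<sigma> (n + 1) j (\<delta> n i x) = \<delta> (n - 1) (i - 1) (\<sigma> n j x)"

locale cocyclic_module = cosimplicial_module R E \<delta> \<sigma>
  for R :: "('r, 'e) ring_scheme"
    and E :: "nat \<Rightarrow> ('r, 'v, 'f) module_scheme"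
    and \<delta> :: "nat \<Rightarrow> nat \<Rightarrow> 'v \<Rightarrow> 'v"
    and \<sigma> :: "nat \<Rightarrow> nat \<Rightarrow> 'v \<Rightarrow> 'v" +
  fixes \<tau> :: "nat \<Rightarrow> 'v \<Rightarrow> 'v"
  assumes cyclic_map: "module_map R (E n) (E n) (\<tau> n)"
    and cyclic_coface:
      "\<lbrakk>1 \<le> i; i \<le> n + 1; x \<in> carrier (E n)\<rbrakk> \<Longrightarrow> \<tau> (n + 1) (\<delta> n i x) = \<delta> n (i - 1) (\<tau> n x)"
    and cyclic_coface_0:
      "x \<in> carrier (E n) \<Longrightarrow> \<tau> (n + 1) (\<delta> n 0 x) = \<delta> n (n + 1) x"
    and cyclic_codegeneracy:
      "\<lbrakk>1 \<le> i; i \<le> n; x \<in> carrier (E (n + 1))\<rbrakk> \<Longrightarrow>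
        \<tau> n (\<sigma> (n + 1) i x) = \<sigma> (n + 1) (i - 1) (\<tau> (n + 1) x)"
    and cyclic_codegeneracy_0:
      "x \<in> carrier (E (n + 1)) \<Longrightarrow>
        \<tau> n (\<sigma> (n + 1) 0 x) = \<sigma> (n + 1) n (\<tau> (n + 1) (\<tau> (n + 1) x))"
    and cyclic_power: "x \<in> carrier (E n) \<Longrightarrow> (\<tau> n ^^ (n + 1)) x = x"


section \<open>Hopf cyclic coefficients\<close>

text \<open>
  \<open>MC_space N\<close> is \<open>M \<otimes> C\<^sup>\<otimes>\<^sup>N\<close>, and \<open>balanced H C M N\<close> is the subspace by which it is divided
  to obtain \<open>M \<otimes>\<^sub>H C\<^sup>\<otimes>\<^sup>N\<close>. The index \<open>N\<close> counts tensor factors, so \<open>C\<^sup>n(C, M)\<close> is \<open>MC_space (n + 1)\<close>.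
\<close>

definition MC_space :: "nat \<Rightarrow> ('m::complex_vector, 'c::complex_vector tpow) tensor set"
  where "MC_space N = complex_vector.span {m \<otimes>\<^sub>C d | m d. d \<in> tpow_space N}"

definition balanced :: "'h::complex_vector hopf \<Rightarrow> ('h, 'c::complex_vector) module_coalg \<Rightarrow>
    ('h, 'm::complex_vector) modcomod \<Rightarrow> nat \<Rightarrow> ('m, 'c tpow) tensor set"
  where "balanced H C M N = complex_vector.span
    {ract M m h \<otimes>\<^sub>C d - m \<otimes>\<^sub>C diag H C h d | m h d. d \<in> tpow_space N}"

definition tensor_over :: "'h::complex_vector hopf \<Rightarrow> ('h, 'c::complex_vector) module_coalg \<Rightarrow>
    ('h, 'm::complex_vector) modcomod \<Rightarrow> nat \<Rightarrow> (complex, ('m, 'c tpow) tensor set) Module.module"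
  where "tensor_over H C M N = quotient_space (MC_space N) (balanced H C M N)"

definition CH_AYD :: "'h::complex_vector hopf \<Rightarrow> ('h, 'c::complex_vector) module_coalg \<Rightarrow>
    ('h, 'm::complex_vector) modcomod \<Rightarrow> bool"
  where "CH_AYD H C M \<longleftrightarrow> (\<forall>m h c.
    tlift (\<lambda>x m0. lact C x c \<otimes>\<^sub>C m0) (coact M (ract M m h)) =
    tlift (\<lambda>h1 h'. tlift (\<lambda>h2 h3. tlift (\<lambda>x m0.
          lact C (times_of H (times_of H (antipode H h3) x) h1) c \<otimes>\<^sub>C ract M m0 h2)
        (coact M m)) (comult H h')) (comult H h))"

definition CH_stable :: "'h::complex_vector hopf \<Rightarrow> ('h, 'c::complex_vector) module_coalg \<Rightarrow>
    ('h, 'm::complex_vector) modcomod \<Rightarrow> bool"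
  where "CH_stable H C M \<longleftrightarrow> (\<forall>n\<ge>1. \<forall>m. \<forall>d\<in>tpow_space n.
    coset (balanced H C M n) (tlift (\<lambda>x m0. m0 \<otimes>\<^sub>C diag H C x d) (coact M m)) =
    coset (balanced H C M n) (m \<otimes>\<^sub>C d))"

definition CH_SAYD :: "'h::complex_vector hopf \<Rightarrow> ('h, 'c::complex_vector) module_coalg \<Rightarrow>
    ('h, 'm::complex_vector) modcomod \<Rightarrow> bool"
  where "CH_SAYD H C M \<longleftrightarrow>
    right_left_module_comodule H M \<and> CH_AYD H C M \<and> CH_stable H C M"

text \<open>
  The linear map on \<open>M \<otimes> C\<^sup>\<otimes>\<^sup>N\<close> given by \<open>f m [c\<^sub>1, \<dots>, c\<^sub>N]\<close> on pure tensors. It is extended by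
  zero to the other degrees, so that \<open>f\<close> need only be multilinear on lists of length \<open>N\<close>.
\<close>

definition MC_lift :: "nat \<Rightarrow> ('m::complex_vector \<Rightarrow> 'c::complex_vector list \<Rightarrow> 'v::complex_vector) \<Rightarrow>
    ('m, 'c tpow) tensor \<Rightarrow> 'v"
  where "MC_lift N f =
    tlift (\<lambda>m. tpow_lift (\<lambda>cs. if length cs = N then f m cs else 0))"

definition coface :: "('h::complex_vector, 'c::complex_vector) module_coalg \<Rightarrow>
    ('h, 'm::complex_vector) modcomod \<Rightarrow> nat \<Rightarrow> nat \<Rightarrow> ('m, 'c tpow) tensor \<Rightarrow> ('m, 'c tpow) tensor"
  where "coface C M n i =
    (if i \<le> n then
      MC_lift (n + 1) (\<lambda>m cs. tlift (\<lambda>c1 c2. m \<otimes>\<^sub>C tp (take i cs @ [c1, c2] @ drop (i + 1) cs))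
        (comult C (cs ! i)))
     else
      MC_lift (n + 1) (\<lambda>m cs. tlift (\<lambda>x m0. tlift (\<lambda>c1 c2. m0 \<otimes>\<^sub>C tp ([c2] @ tl cs @ [lact C x c1]))
        (comult C (hd cs))) (coact M m)))"

definition codegeneracy :: "('h::complex_vector, 'c::complex_vector) module_coalg \<Rightarrow>
    nat \<Rightarrow> nat \<Rightarrow> ('m::complex_vector, 'c tpow) tensor \<Rightarrow> ('m, 'c tpow) tensor"
  where "codegeneracy C n i =
    MC_lift (n + 1) (\<lambda>m cs. counit C (cs ! (i + 1)) *\<^sub>C
      (m \<otimes>\<^sub>C tp (take (i + 1) cs @ drop (i + 2) cs)))"

definition cyclic_op :: "('h::complex_vector, 'c::complex_vector) module_coalg \<Rightarrow>
    ('h, 'm::complex_vector) modcomod \<Rightarrow> nat \<Rightarrow> ('m, 'c tpow) tensor \<Rightarrow> ('m, 'c tpow) tensor"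
  where "cyclic_op C M n =
    MC_lift (n + 1) (\<lambda>m cs. tlift (\<lambda>x m0. m0 \<otimes>\<^sub>C tp (tl cs @ [lact C x (hd cs)])) (coact M m))"

definition well_defined_ops :: "'h::complex_vector hopf \<Rightarrow> ('h, 'c::complex_vector) module_coalg \<Rightarrow>
    ('h, 'm::complex_vector) modcomod \<Rightarrow> bool"
  where "well_defined_ops H C M \<longleftrightarrow>
    (\<forall>n. \<forall>i\<le>n + 1. descends (MC_space (n + 1)) (balanced H C M (n + 1))
        (MC_space (n + 2)) (balanced H C M (n + 2)) (coface C M n i)) \<and>
    (\<forall>n. \<forall>i<n. descends (MC_space (n + 1)) (balanced H C M (n + 1))
        (MC_space n) (balanced H C M n) (codegeneracy C n i)) \<and>
    (\<forall>n. descends (MC_space (n + 1)) (balanced H C M (n + 1))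
        (MC_space (n + 1)) (balanced H C M (n + 1)) (cyclic_op C M n))"

definition CH_HCC :: "'h::complex_vector hopf \<Rightarrow> ('h, 'c::complex_vector) module_coalg \<Rightarrow>
    ('h, 'm::complex_vector) modcomod \<Rightarrow> bool"
  where "CH_HCC H C M \<longleftrightarrow>
    right_left_module_comodule H M \<and>
    well_defined_ops H C M \<and>
    cocyclic_module (ring_of_type_algebra :: complex ring)
      (\<lambda>n. tensor_over H C M (n + 1))
      (\<lambda>n i. induced (balanced H C M (n + 2)) (coface C M n i))
      (\<lambda>n i. induced (balanced H C M n) (codegeneracy C n i))
      (\<lambda>n. induced (balanced H C M (n + 1)) (cyclic_op C M n))"

end

theory Submission
  imports Defs
begin

text \<open>
  All cocyclic identities except \<open>\<tau>\<^sub>n\<^sup>n\<^sup>+\<^sup>1 = 1\<close> already hold on \<open>M \<otimes> C\<^sup>\<otimes>\<^sup>n\<^sup>+\<^sup>1\<close>, before dividing by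
  the action of \<open>H\<close>. They use coassociativity and the counit of \<open>C\<close>, the coaction axioms of
  \<open>M\<close> and the compatibility of the action on \<open>C\<close> with comultiplication and counit. Since \<open>\<partial>\<^sub>n\<^sub>+\<^sub>1
  = \<tau> \<partial>\<^sub>0\<close> (\<open>cyclic_coface_first\<close>), most identities involving the last coface follow formally
  from those for the inner cofaces and the commutation of \<open>\<tau>\<close> with the other operators. The
  coassociativity of the coaction enters through \<open>\<tau> \<partial>\<^sub>n\<^sub>+\<^sub>1 = \<partial>\<^sub>n \<tau>\<close> (\<open>cyclic_coface_last\<close>).

  The inner cofaces and the codegeneracies descend to \<open>M \<otimes>\<^sub>H C\<^sup>\<otimes>\<^sup>n\<^sup>+\<^sup>1\<close> because \<open>\<Delta>\<close> and \<open>\<epsilon>\<close> of \<open>C\<close>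
  are \<open>H\<close>-linear, so that they commute with the diagonal action (\<open>diag_sum_comult\<close>,
  \<open>diag_sum_counit\<close>). For \<open>\<tau>\<close> (\<open>cyclic_op_balanced\<close>), the AYD condition and one move of \<open>h\<^sup>(\<^sup>2\<^sup>)\<close>
  across \<open>\<otimes>\<^sub>H\<close> give \<open>\<tau>(mh \<otimes> c \<otimes> d) = m\<^sub>0h\<^sup>(\<^sup>2\<^sup>) \<otimes> d \<otimes> S(h\<^sup>(\<^sup>3\<^sup>))m\<^sub>-\<^sub>1h\<^sup>(\<^sup>1\<^sup>)c \<equiv> m\<^sub>0 \<otimes> h\<^sup>(\<^sup>2\<^sup>)d \<otimes>
  h\<^sup>(\<^sup>3\<^sup>)S(h\<^sup>(\<^sup>4\<^sup>))m\<^sub>-\<^sub>1h\<^sup>(\<^sup>1\<^sup>)c = m\<^sub>0 \<otimes> h\<^sup>(\<^sup>2\<^sup>)d \<otimes> m\<^sub>-\<^sub>1h\<^sup>(\<^sup>1\<^sup>)c = \<tau>(m \<otimes> h\<^sup>(\<^sup>1\<^sup>)c \<otimes> h\<^sup>(\<^sup>2\<^sup>)d)\<close>. The last coface then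
  descends as \<open>\<tau> \<partial>\<^sub>0\<close>. Finally, rotating all \<open>n + 1\<close> factors lets \<open>m\<^sub>-\<^sub>1\<close> act diagonally, \<open>\<tau>\<^sup>n\<^sup>+\<^sup>1(m
  \<otimes> d) = m\<^sub>0 \<otimes> m\<^sub>-\<^sub>1d\<close> (\<open>cyclic_op_iterate\<close>), and stability says that this is \<open>m \<otimes> d\<close> in the
  quotient.

  Sweedler sums are the terms \<open>tlift f (comult X c)\<close>. For every \<open>f\<close> such a term is a finite
  sum over a chosen representative of the tensor, so linear maps can be pushed inside and
  nested sums can be interchanged freely; linearity of \<open>f\<close> enters only where an axiom replaces
  the tensor itself. For the same reason the diagonal action is written as \<open>diag_sum H C cs F
  h\<close>, the value \<open>F [h\<^sup>(\<^sup>1\<^sup>)c\<^sub>1, \<dots>, h\<^sup>(\<^sup>N\<^sup>)c\<^sub>N]\<close> summed over nested coproducts of \<open>h\<close>: its summands are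
  lists of the same length as \<open>cs\<close>, on which the formulas for the operators apply.
\<close>


section \<open>Linear maps and linear slots\<close>

lemma clinear_plus: "clinear f \<Longrightarrow> f (x + y) = f x + f y"
  by (rule module_hom.add[OF Vector_Spaces.linear.axioms(3)])

lemma clinear_scaleC: "clinear f \<Longrightarrow> f (r *\<^sub>C x) = r *\<^sub>C f x"
  by (rule module_hom.scale[OF Vector_Spaces.linear.axioms(3)])

lemma clinear_minus: "clinear f \<Longrightarrow> f (x - y) = f x - f y"
  by (rule module_hom.diff[OF Vector_Spaces.linear.axioms(3)])

lemma clinear_zero: "clinear f \<Longrightarrow> f 0 = 0"
  by (rule module_hom.zero[OF Vector_Spaces.linear.axioms(3)])

lemma clinear_sum: "clinear f \<Longrightarrow> f (sum g A) = (\<Sum>x\<in>A. f (g x))"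
  by (rule module_hom.sum[OF Vector_Spaces.linear.axioms(3)])

lemmas clinear_simps = clinear_plus clinear_scaleC clinear_minus clinear_zero

named_theorems clin \<open>introduction rules for linearity in one variable\<close>

lemma cbilinearI [clin]:
  assumes "\<And>a. clinear (f a)" and "\<And>b. clinear (\<lambda>a. f a b)"
  shows "cbilinear f"
  using assms by (simp add: cbilinear_def)

lemma clinear_id [clin]: "clinear (\<lambda>x. x)"
  by (rule clinearI) simp_all

lemma clinear_const_0 [clin]: "clinear (\<lambda>x. 0)"
  by (rule clinearI) simp_all

lemma clinear_compose: "clinear g \<Longrightarrow> clinear f \<Longrightarrow> clinear (\<lambda>x. g (f x))"
  by (rule clinearI) (simp_all add: clinear_simps)

lemma clinear_scaleC_right [clin]: "clinear f \<Longrightarrow> clinear (\<lambda>x. r *\<^sub>C f x)"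
  by (rule clinearI) (simp_all add: clinear_simps scaleC_add_right scaleC_scaleC mult.commute)

lemma clinear_scaleC_left [clin]: "clinear f \<Longrightarrow> clinear (\<lambda>x. f x *\<^sub>C v)"
  by (rule clinearI) (simp_all add: clinear_simps scaleC_add_left scaleC_scaleC
      scaleC_complex_def)

lemma cbilinear_left: "cbilinear B \<Longrightarrow> clinear f \<Longrightarrow> clinear (\<lambda>x. B (f x) b)"
  by (rule clinear_compose[where g = "\<lambda>a. B a b"]) (simp_all add: cbilinear_def)

lemma cbilinear_right: "cbilinear B \<Longrightarrow> clinear f \<Longrightarrow> clinear (\<lambda>x. B a (f x))"
  by (rule clinear_compose[where g = "B a"]) (simp_all add: cbilinear_def)

lemmas clinear_tensor [clin] =
  cbilinear_left[OF cbilinear_tensor] cbilinear_right[OF cbilinear_tensor]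

text \<open>
  A list-valued map in which the variable enters linearly at exactly one position. A
  multilinear function composed with it is linear, and the closure rules below find the
  position by following the shape of the list, with no need to write it as \<open>us @ a # vs\<close>.
\<close>

definition linear_slot :: "('v::complex_vector \<Rightarrow> 'c::complex_vector list) \<Rightarrow> bool"
  where "linear_slot L \<longleftrightarrow> (\<exists>us f vs. clinear f \<and> L = (\<lambda>a. us @ f a # vs))"

lemma linear_slot_here [clin]: "clinear f \<Longrightarrow> linear_slot (\<lambda>a. f a # vs)"
  unfolding linear_slot_def by (rule exI[of _ "[]"]) auto

lemma linear_slot_append_right [clin]: "linear_slot L \<Longrightarrow> linear_slot (\<lambda>a. us @ L a)"
  unfolding linear_slot_def by (metis append.assoc)

lemma linear_slot_Cons [clin]: "linear_slot L \<Longrightarrow> linear_slot (\<lambda>a. x # L a)"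
  using linear_slot_append_right[of L "[x]"] by simp

lemma linear_slot_append_left [clin]: "linear_slot L \<Longrightarrow> linear_slot (\<lambda>a. L a @ ws)"
  unfolding linear_slot_def by (metis append.assoc append_Cons)

lemma multilinearI: "(\<And>xs ys. clinear (\<lambda>a. F (xs @ a # ys))) \<Longrightarrow> multilinear F"
  by (simp add: multilinear_def)

lemma clinear_multilinear:
  assumes "multilinear F" and "linear_slot L"
  shows "clinear (\<lambda>a. F (L a))"
  using assms unfolding linear_slot_def multilinear_def
  by (auto intro: clinear_compose[where g = "\<lambda>b. F (_ @ b # _)"])

lemmas clinear_tp [clin] = clinear_multilinear[OF multilinear_tp]

lemma clinear_span:
  assumes "clinear f" and "\<And>x. x \<in> S \<Longrightarrow> f x \<in> complex_vector.span T"
    and "x \<in> complex_vector.span S"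
  shows "f x \<in> complex_vector.span T"
  using assms(3)
proof (induction rule: complex_vector.span_induct_alt)
  case base
  then show ?case by (simp add: clinear_zero[OF assms(1)] complex_vector.span_zero)
next
  case (step c x y)
  then show ?case
    by (simp add: clinear_simps[OF assms(1)] complex_vector.span_add
        complex_vector.span_scale assms(2))
qed

lemma clinear_eq_on_span:
  assumes "clinear f" and "clinear g" and "\<And>x. x \<in> S \<Longrightarrow> f x = g x"
    and "x \<in> complex_vector.span S"
  shows "f x = g x"
  using assms(4)
  by (induction rule: complex_vector.span_induct_alt)
    (simp_all add: clinear_simps[OF assms(1)] clinear_simps[OF assms(2)] assms(3))


section \<open>Sweedler sums\<close>

lemma free_lift_linear: "clinear g \<Longrightarrow> g (free_lift f p) = free_lift (\<lambda>k. g (f k)) p"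
  by (simp add: free_lift_def clinear_sum clinear_scaleC)

text \<open>
  \<open>tlift f t\<close> is a finite linear combination of values of \<open>f\<close>, taken over the chosen
  representative of \<open>t\<close>. This gives linearity in a parameter of \<open>f\<close>, and Fubini for nested
  sums, for every \<open>f\<close>.
\<close>

lemma tlift_linear: "clinear g \<Longrightarrow> g (tlift f t) = tlift (\<lambda>x y. g (f x y)) t"
  by (simp add: tlift_def free_lift_linear case_prod_unfold)

lemma clinear_tlift_param [clin]:
  assumes "\<And>a b. clinear (\<lambda>x. F x a b)"
  shows "clinear (\<lambda>x. tlift (F x) t)"
  unfolding tlift_def free_lift_def case_prod_unfold
  by (rule clinearI)
    (simp_all add: clinear_simps[OF assms] scaleC_add_right sum.distrib
      complex_vector.scale_sum_right scaleC_scaleC mult.commute)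

lemma clinear_tpow_lift_param [clin]:
  assumes "\<And>xs. clinear (\<lambda>x. F x xs)"
  shows "clinear (\<lambda>x. tpow_lift (F x) t)"
  unfolding tpow_lift_def free_lift_def
  by (rule clinearI)
    (simp_all add: clinear_simps[OF assms] scaleC_add_right sum.distrib
      complex_vector.scale_sum_right scaleC_scaleC mult.commute)

lemma clinear_tlift_arg [clin]:
  "cbilinear f \<Longrightarrow> clinear g \<Longrightarrow> clinear (\<lambda>x. tlift f (g x))"
  by (rule clinear_compose[OF clinear_tlift])

lemma tlift_swap:
  "tlift (\<lambda>x y. tlift (\<lambda>u v. F x y u v) s) t = tlift (\<lambda>u v. tlift (\<lambda>x y. F x y u v) t) s"
  unfolding tlift_def free_lift_def case_prod_unfold complex_vector.scale_sum_right
  by (subst sum.swap) (simp add: scaleC_scaleC mult.commute)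

lemma tlift_tlift:
  "cbilinear f \<Longrightarrow> tlift f (tlift g t) = tlift (\<lambda>x y. tlift f (g x y)) t"
  by (rule tlift_linear[OF clinear_tlift])

lemma tlift_in_span:
  assumes "\<And>x y. f x y \<in> complex_vector.span S"
  shows "tlift f t \<in> complex_vector.span S"
  unfolding tlift_def free_lift_def case_prod_unfold
  by (intro complex_vector.span_sum complex_vector.span_scale assms)

lemma tlift_minus: "tlift f t - tlift g t = tlift (\<lambda>x y. f x y - g x y) t"
  unfolding tlift_def free_lift_def case_prod_unfold
  by (simp add: sum_subtractf complex_vector.scale_right_diff_distrib)

text \<open>
  The axiom is an identity in \<open>A \<otimes> A \<otimes> A\<close>; applying the linear map induced by a trilinear \<open>F\<close>
  turns it into an identity between Sweedler sums of arbitrary shape.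
\<close>

lemma coassociativity:
  assumes A: "coalgebra A"
    and F: "\<And>y z. clinear (\<lambda>x. F x y z)" "\<And>x z. clinear (\<lambda>y. F x y z)" "\<And>x y. clinear (\<lambda>z. F x y z)"
  shows "tlift (\<lambda>x z. tlift (\<lambda>u v. F u v z) (comult A x)) (comult A c)
    = tlift (\<lambda>x y. tlift (\<lambda>u v. F x u v) (comult A y)) (comult A c)"
proof -
  let ?g = "tlift (\<lambda>u. tlift (\<lambda>v z. F u v z))"
  have g2: "cbilinear (\<lambda>v z. F u v z)" for u by (intro clin F)
  have g1: "cbilinear (\<lambda>u. tlift (\<lambda>v z. F u v z))" by (intro clin F clinear_tlift)
  have g: "clinear ?g" by (rule clinear_tlift[OF g1])
  have "?g (tlift (\<lambda>x y. tlift (\<lambda>u v. u \<otimes>\<^sub>C v \<otimes>\<^sub>C y) (comult A x)) (comult A c))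
     = ?g (tlift (\<lambda>x y. x \<otimes>\<^sub>C comult A y) (comult A c))"
    using A by (simp add: coalgebra_def)
  then show ?thesis
    by (simp add: tlift_linear[OF g] tlift_tensor[OF g1] tlift_tensor[OF g2])
qed

lemma counit_left:
  assumes "coalgebra A" and "clinear F"
  shows "tlift (\<lambda>x y. counit A x *\<^sub>C F y) (comult A c) = F c"
proof -
  have "F (tlift (\<lambda>x y. counit A x *\<^sub>C y) (comult A c)) = F c"
    using assms(1) by (simp add: coalgebra_def)
  then show ?thesis by (simp add: tlift_linear[OF assms(2)] clinear_scaleC[OF assms(2)])
qed

lemma counit_right:
  assumes "coalgebra A" and "clinear F"
  shows "tlift (\<lambda>x y. counit A y *\<^sub>C F x) (comult A c) = F c"
proof -
  have "F (tlift (\<lambda>x y. counit A y *\<^sub>C x) (comult A c)) = F c"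
    using assms(1) by (simp add: coalgebra_def)
  then show ?thesis by (simp add: tlift_linear[OF assms(2)] clinear_scaleC[OF assms(2)])
qed

section \<open>Linear maps defined on pure tensors\<close>

text \<open>
  \<open>MC_lift\<close> extends \<open>f\<close> by zero to lists of other lengths, so linearity in each slot has to be
  checked on lists of length \<open>N\<close> only.
\<close>

lemma MC_lift_linear_and_pure:
  assumes mult: "\<And>m us vs. length us + length vs + 1 = N \<Longrightarrow> clinear (\<lambda>a. f m (us @ a # vs))"
    and lin: "\<And>cs. length cs = N \<Longrightarrow> clinear (\<lambda>m. f m cs)"
  shows clinear_MC_lift: "clinear (MC_lift N f)"
    and MC_lift_pure: "length cs = N \<Longrightarrow> MC_lift N f (m \<otimes>\<^sub>C tp cs) = f m cs"
proof -
  let ?f = "\<lambda>m cs. if length cs = N then f m cs else 0"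
  have 1: "multilinear (?f m)" for m
  proof (rule multilinearI)
    show "clinear (\<lambda>a. ?f m (us @ a # vs))" for us vs
      using mult[of us vs m] clinear_const_0 by (cases "length us + length vs + 1 = N") auto
  qed
  have 2: "clinear (\<lambda>m. ?f m cs)" for cs
    using lin[of cs] clinear_const_0 by (cases "length cs = N") auto
  have 3: "cbilinear (\<lambda>m. tpow_lift (?f m))"
    by (intro cbilinearI clinear_tpow_lift clinear_tpow_lift_param 1 2)
  show "clinear (MC_lift N f)"
    unfolding MC_lift_def by (rule clinear_tlift[OF 3])
  show "MC_lift N f (m \<otimes>\<^sub>C tp cs) = f m cs" if "length cs = N"
    by (simp add: MC_lift_def tlift_tensor[OF 3] tpow_lift_tp[OF 1] that)
qed

lemma MC_space_pure: "length cs = N \<Longrightarrow> m \<otimes>\<^sub>C tp cs \<in> MC_space N"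
  unfolding MC_space_def tpow_space_def
  by (rule complex_vector.span_base) (blast intro: complex_vector.span_base)

lemma MC_space_eq: "MC_space N = complex_vector.span {m \<otimes>\<^sub>C tp cs | m cs. length cs = N}"
  (is "_ = complex_vector.span ?P")
proof
  have "m \<otimes>\<^sub>C d \<in> complex_vector.span ?P" if "d \<in> tpow_space N" for m :: 'a and d :: "'b tpow"
    using that unfolding tpow_space_def
    by (rule clinear_span[rotated 2])
      (auto intro!: clin complex_vector.span_base)
  then show "MC_space N \<subseteq> complex_vector.span ?P"
    unfolding MC_space_def by (intro complex_vector.span_minimal) auto
  show "complex_vector.span ?P \<subseteq> MC_space N"
    by (rule complex_vector.span_minimal) (auto simp: MC_space_pure, simp add: MC_space_def)
qed

lemma MC_space_ext:
  assumes "clinear f" and "clinear g" and "v \<in> MC_space N"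
    and "\<And>m cs. length cs = N \<Longrightarrow> f (m \<otimes>\<^sub>C tp cs) = g (m \<otimes>\<^sub>C tp cs)"
  shows "f v = g v"
  using assms(3) unfolding MC_space_eq
  by (rule clinear_eq_on_span[OF assms(1,2), rotated]) (use assms(4) in auto)

lemma MC_space_image:
  assumes "clinear f" and "v \<in> MC_space N"
    and "\<And>m cs. length cs = N \<Longrightarrow> f (m \<otimes>\<^sub>C tp cs) \<in> MC_space N'"
  shows "f v \<in> MC_space N'"
  using assms(2) unfolding MC_space_eq
  by (rule clinear_span[OF assms(1), rotated])
    (use assms(3)[unfolded MC_space_eq] in auto)

lemma tlift_in_MC_space: "(\<And>x y. f x y \<in> MC_space N) \<Longrightarrow> tlift f t \<in> MC_space N"
  unfolding MC_space_def by (rule tlift_in_span)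

lemma list_split_nth:
  assumes "i < length cs"
  obtains xs c ys where "cs = xs @ c # ys" and "length xs = i"
  using assms id_take_nth_drop[of i cs] by (metis length_take min.absorb4)

lemma list_split_nth2:
  assumes "i < j" "j < length cs"
  obtains xs c ys d zs where "cs = xs @ c # ys @ d # zs" "length xs = i" "length ys = j - i - 1"
proof -
  from assms have "i < length cs" by simp
  then obtain xs c ys where 1: "cs = xs @ c # ys" "length xs = i" by (rule list_split_nth)
  with assms have "j - i - 1 < length ys" by simp
  then obtain ys' d zs where "ys = ys' @ d # zs" "length ys' = j - i - 1" by (rule list_split_nth)
  with 1 that show thesis by simp
qed


section \<open>Hopf algebras, module coalgebras and module-comodules\<close>

locale hopf_coefficients =
  fixes H :: "'h::complex_vector hopf"
    and C :: "('h, 'c::complex_vector) module_coalg"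
    and M :: "('h, 'm::complex_vector) modcomod"
  assumes hopf: "hopf_algebra H"
    and module_coalgebra: "left_module_coalgebra H C"
    and module_comodule: "right_left_module_comodule H M"
begin

lemma coalgebra_H: "coalgebra H" and coalgebra_C: "coalgebra C"
  using hopf module_coalgebra by (simp_all add: hopf_algebra_def left_module_coalgebra_def)

lemma structure_maps_bilinear:
  "cbilinear (times_of H)" "cbilinear (lact C)" "cbilinear (ract M)"
  using hopf module_coalgebra module_comodule
  by (simp_all add: hopf_algebra_def left_module_coalgebra_def right_left_module_comodule_def)

lemma structure_maps_linear:
  "clinear (comult H)" "clinear (counit H)" "clinear (comult C)" "clinear (counit C)"
  "clinear (antipode H)" "clinear (coact M)"
  using hopf coalgebra_H coalgebra_C module_comodule
  by (simp_all add: hopf_algebra_def coalgebra_def right_left_module_comodule_def)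

lemmas clinear_structure_maps [clin] =
  structure_maps_bilinear[THEN cbilinear_left] structure_maps_bilinear[THEN cbilinear_right]
  structure_maps_linear[THEN clinear_compose]

lemma lact_unit [simp]: "lact C (unit_of H) c = c"
  and lact_times: "lact C (times_of H g h) c = lact C g (lact C h c)"
  and counit_lact: "counit C (lact C h c) = counit H h * counit C c"
  and comult_lact: "comult C (lact C h c) =
      tlift (\<lambda>h1 h2. tlift (\<lambda>c1 c2. lact C h1 c1 \<otimes>\<^sub>C lact C h2 c2) (comult C c)) (comult H h)"
  using module_coalgebra by (simp_all add: left_module_coalgebra_def)

lemma tlift_comult_lact:
  assumes "cbilinear F"
  shows "tlift F (comult C (lact C h c)) =
    tlift (\<lambda>h1 h2. tlift (\<lambda>c1 c2. F (lact C h1 c1) (lact C h2 c2)) (comult C c)) (comult H h)"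
  by (simp add: comult_lact tlift_tlift[OF assms] tlift_tensor[OF assms])

lemma coaction_coassociativity:
  assumes F: "\<And>y z. clinear (\<lambda>x. F x y z)" "\<And>x z. clinear (\<lambda>y. F x y z)" "\<And>x y. clinear
      (\<lambda>z. F x y z)"
  shows "tlift (\<lambda>x m0. tlift (\<lambda>y m1. F x y m1) (coact M m0)) (coact M m)
    = tlift (\<lambda>x m0. tlift (\<lambda>x1 x2. F x1 x2 m0) (comult H x)) (coact M m)"
proof -
  let ?g = "tlift (\<lambda>u. tlift (\<lambda>v z. F u v z))"
  have g2: "cbilinear (\<lambda>v z. F u v z)" for u by (intro clin F)
  have g1: "cbilinear (\<lambda>u. tlift (\<lambda>v z. F u v z))" by (intro clin F clinear_tlift)
  have g: "clinear ?g" by (rule clinear_tlift[OF g1])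
  have "?g (tlift (\<lambda>x m'. tlift (\<lambda>u v. u \<otimes>\<^sub>C v \<otimes>\<^sub>C m') (comult H x)) (coact M m))
     = ?g (tlift (\<lambda>x m'. x \<otimes>\<^sub>C coact M m') (coact M m))"
    using module_comodule by (simp add: right_left_module_comodule_def)
  then show ?thesis
    by (simp add: tlift_linear[OF g] tlift_tensor[OF g1] tlift_tensor[OF g2])
qed

lemma coaction_counit:
  assumes "clinear F"
  shows "tlift (\<lambda>x m0. counit H x *\<^sub>C F m0) (coact M m) = F m"
proof -
  have "F (tlift (\<lambda>x m0. counit H x *\<^sub>C m0) (coact M m)) = F m"
    using module_comodule by (simp add: right_left_module_comodule_def)
  then show ?thesis by (simp add: tlift_linear[OF assms] clinear_scaleC[OF assms])
qed

text \<open>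
  In Sweedler notation \<open>F(h\<^sup>(\<^sup>1\<^sup>), h\<^sup>(\<^sup>2\<^sup>)S(h\<^sup>(\<^sup>3\<^sup>))) = F(h\<^sup>(\<^sup>1\<^sup>), \<epsilon>(h\<^sup>(\<^sup>2\<^sup>))1) = F(h, 1)\<close>.
\<close>

lemma antipode_cancel:
  assumes F: "cbilinear F"
  shows "tlift (\<lambda>h1 h2. tlift (\<lambda>a b. F a (times_of H b (antipode H h2))) (comult H h1)) (comult H h)
    = F h (unit_of H)"
proof -
  note lin = cbilinear_left[OF F] cbilinear_right[OF F]
  have "tlift (\<lambda>h1 h2. tlift (\<lambda>a b. F a (times_of H b (antipode H h2))) (comult H h1)) (comult H h)
    = tlift (\<lambda>a e. tlift (\<lambda>b h2. F a (times_of H b (antipode H h2))) (comult H e)) (comult H h)"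
    by (rule coassociativity[OF coalgebra_H]) (intro clin lin)+
  also have "\<dots> = tlift (\<lambda>a e. F a (counit H e *\<^sub>C unit_of H)) (comult H h)"
  proof -
    have "tlift (\<lambda>b h2. F a (times_of H b (antipode H h2))) (comult H e)
      = F a (tlift (\<lambda>b h2. times_of H b (antipode H h2)) (comult H e))" for a e
      by (rule tlift_linear[symmetric]) (intro clin lin)
    then show ?thesis using hopf by (simp add: hopf_algebra_def)
  qed
  also have "\<dots> = tlift (\<lambda>a e. counit H e *\<^sub>C F a (unit_of H)) (comult H h)"
    using F by (simp add: cbilinear_def clinear_scaleC)
  also have "\<dots> = F h (unit_of H)"
    by (rule counit_right[OF coalgebra_H]) (intro clin lin)
  finally show ?thesis .
qed

end


section \<open>The diagonal action as a sum over lists\<close>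

text \<open>
  The value \<open>F [h\<^sup>(\<^sup>1\<^sup>)c\<^sub>1, \<dots>, h\<^sup>(\<^sup>N\<^sup>)c\<^sub>N]\<close> in Sweedler notation. Passing the continuation \<open>F\<close> down
  the list avoids elements of the tensor algebra, whose chosen representatives may contain
  lists of any length.
\<close>

primrec diag_sum :: "'h::complex_vector hopf \<Rightarrow> ('h, 'c::complex_vector) module_coalg \<Rightarrow>
    'c list \<Rightarrow> ('c list \<Rightarrow> 'v::complex_vector) \<Rightarrow> 'h \<Rightarrow> 'v"
  where
    "diag_sum H C [] F h = counit H h *\<^sub>C F []"
  | "diag_sum H C (c # cs) F h =
      tlift (\<lambda>h1 h2. diag_sum H C cs (\<lambda>ds. F (lact C h1 c # ds)) h2) (comult H h)"

lemma clinear_diag_sum_param [clin]: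
  "(\<And>ds. clinear (\<lambda>a. F a ds)) \<Longrightarrow> clinear (\<lambda>a. diag_sum H C cs (F a) h)"
  by (induction cs arbitrary: F h) (auto intro!: clinear_scaleC_right clinear_tlift_param)

lemma diag_sum_linear:
  "clinear g \<Longrightarrow> g (diag_sum H C cs F h) = diag_sum H C cs (\<lambda>ds. g (F ds)) h"
  by (induction cs arbitrary: F h) (simp_all add: clinear_scaleC tlift_linear)

text \<open>
  Only lists as long as \<open>cs\<close> occur in the sum, so a formula for an operator that is valid in a
  single degree may be applied inside it.
\<close>

lemma diag_sum_cong:
  "(\<And>ds. length ds = length cs \<Longrightarrow> F ds = G ds) \<Longrightarrow> diag_sum H C cs F h = diag_sum H C cs G h"
proof (induction cs arbitrary: F G h)
  case (Cons c cs)
  have "diag_sum H C cs (\<lambda>ds. F (lact C h1 c # ds)) h2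
      = diag_sum H C cs (\<lambda>ds. G (lact C h1 c # ds)) h2" for h1 h2
    by (rule Cons.IH) (simp add: Cons.prems)
  then show ?case by simp
qed simp

lemma diag_sum_in_span:
  "(\<And>ds. length ds = length cs \<Longrightarrow> F ds \<in> complex_vector.span S) \<Longrightarrow>
    diag_sum H C cs F h \<in> complex_vector.span S"
  by (induction cs arbitrary: F h) (auto intro!: complex_vector.span_scale tlift_in_span)

lemma tlift_diag_sum:
  "tlift (\<lambda>x y. diag_sum H C cs (F x y) h) t = diag_sum H C cs (\<lambda>ds. tlift (\<lambda>x y. F x y ds) t) h"
proof (induction cs arbitrary: F h)
  case Nil
  show ?case by (simp add: tlift_linear[symmetric, OF clinear_scaleC_right[OF clinear_id]])
next
  case (Cons c cs)
  show ?case by (simp add: tlift_swap[of _ "comult H h"] Cons.IH)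
qed

context hopf_coefficients
begin

lemma clinear_diag_sum:
  "multilinear F \<Longrightarrow> clinear (diag_sum H C cs F)"
proof (induction cs arbitrary: F)
  case Nil
  have "diag_sum H C [] F = (\<lambda>h. counit H h *\<^sub>C F [])"
    by (rule ext) simp
  then show ?case by (simp only:) (intro clin)
next
  case (Cons c cs)
  note lin = clinear_multilinear[OF Cons.prems]
  have "diag_sum H C (c # cs) F =
      (\<lambda>h. tlift (\<lambda>h1 h2. diag_sum H C cs (\<lambda>ds. F (lact C h1 c # ds)) h2) (comult H h))"
    by (rule ext) simp
  then show ?case by (simp only:) (intro clin Cons.IH multilinearI lin)
qed

lemmas clinear_diag_sum_arg [clin] = clinear_compose[OF clinear_diag_sum]

lemma clinear_diag_sum_slot:
  assumes "multilinear F"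
  shows "clinear (\<lambda>a. diag_sum H C (us @ a # vs) F h)"
  using assms
proof (induction us arbitrary: F h)
  case Nil
  note lin = clinear_multilinear[OF Nil.prems]
  show ?case by simp (intro clin lin)
next
  case (Cons c us)
  note lin = clinear_multilinear[OF Cons.prems]
  show ?case by simp (intro clin Cons.IH multilinearI lin)
qed

lemma diag_list_eq: "diag_list H C h cs = diag_sum H C cs tp h"
proof (induction cs arbitrary: h)
  case (Cons c cs)
  have *: "multilinear (\<lambda>ds. tp (lact C h1 c # ds))" for h1
    by (intro multilinearI clin)
  show ?case
    by (simp add: Cons.IH diag_sum_linear[OF clinear_tpow_lift[OF *]] tpow_lift_tp[OF *])
qed simp

lemma multilinear_diag_list: "multilinear (diag_list H C h)"
  by (rule multilinearI) (simp add: diag_list_eq clinear_diag_sum_slot multilinear_tp)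

lemma clinear_diag: "clinear (diag H C h)"
  unfolding diag_def by (rule clinear_tpow_lift[OF multilinear_diag_list])

lemma diag_tp: "diag H C h (tp cs) = diag_sum H C cs tp h"
  by (simp add: diag_def tpow_lift_tp[OF multilinear_diag_list] diag_list_eq)

text \<open>
  The recursion splits off the first factor of \<open>h\<close>; by coassociativity the last one can be
  split off instead, which is what \<open>\<tau>\<close> requires since it appends its new entry at the end.
\<close>

lemma diag_sum_snoc:
  assumes "multilinear F"
  shows "diag_sum H C (cs @ [d]) F h =
    tlift (\<lambda>h1 h2. diag_sum H C cs (\<lambda>us. F (us @ [lact C h2 d])) h1) (comult H h)"
  using assms
proof (induction cs arbitrary: F h)
  case Nil
  note lin = clinear_multilinear[OF Nil.prems]
  have "tlift (\<lambda>h1 h2. counit H h2 *\<^sub>C F [lact C h1 d]) (comult H h) = F [lact C h d]"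
    by (rule counit_right[OF coalgebra_H]) (intro clin lin)
  moreover have "tlift (\<lambda>h1 h2. counit H h1 *\<^sub>C F [lact C h2 d]) (comult H h) = F [lact C h d]"
    by (rule counit_left[OF coalgebra_H]) (intro clin lin)
  ultimately show ?case by simp
next
  case (Cons c cs)
  note lin = clinear_multilinear[OF Cons.prems]
  let ?F = "\<lambda>h1 h2 h3. diag_sum H C cs (\<lambda>us. F (lact C h1 c # us @ [lact C h3 d])) h2"
  have "diag_sum H C (cs @ [d]) (\<lambda>ds. F (lact C h1 c # ds)) h' =
      tlift (\<lambda>h2 h3. ?F h1 h2 h3) (comult H h')" for h1 h'
    by (subst Cons.IH) (intro multilinearI lin clin, simp)
  moreover have "tlift (\<lambda>h' h3. tlift (\<lambda>h1 h2. ?F h1 h2 h3) (comult H h')) (comult H h)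
     = tlift (\<lambda>h1 h'. tlift (\<lambda>h2 h3. ?F h1 h2 h3) (comult H h')) (comult H h)"
    by (rule coassociativity[OF coalgebra_H]) (intro multilinearI clin lin)+
  ultimately show ?case by simp
qed

text \<open>
  Comultiplying one entry commutes with the diagonal action, because \<open>\<Delta>(hc) = h\<^sup>(\<^sup>1\<^sup>)c\<^sup>(\<^sup>1\<^sup>) \<otimes>
  h\<^sup>(\<^sup>2\<^sup>)c\<^sup>(\<^sup>2\<^sup>)\<close>. The function \<open>G\<close> is \<open>F\<close> with the entry at position \<open>length xs\<close> comultiplied.
\<close>

lemma diag_sum_comult:
  assumes "multilinear F"
    and "\<And>us d vs. length us = length xs \<Longrightarrow>
      G (us @ d # vs) = tlift (\<lambda>d1 d2. F (us @ d1 # d2 # vs)) (comult C d)"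
  shows "tlift (\<lambda>c1 c2. diag_sum H C (xs @ c1 # c2 # ys) F h) (comult C c)
    = diag_sum H C (xs @ c # ys) G h"
  using assms
proof (induction xs arbitrary: F G h)
  case Nil
  note lin = clinear_multilinear[OF Nil.prems(1)]
  have G: "G (d # vs) = tlift (\<lambda>d1 d2. F (d1 # d2 # vs)) (comult C d)" for d vs
    using Nil.prems(2)[of "[]"] by simp
  have bil: "cbilinear (\<lambda>d1 d2. F (d1 # d2 # vs))" for vs
    by (intro clin lin)
  let ?F = "\<lambda>h1 h2 h3 c1 c2. diag_sum H C ys (\<lambda>ds. F (lact C h1 c1 # lact C h2 c2 # ds)) h3"
  have "tlift (\<lambda>c1 c2. diag_sum H C (c1 # c2 # ys) F h) (comult C c)
    = tlift (\<lambda>h1 h'. tlift (\<lambda>h2 h3. tlift (\<lambda>c1 c2. ?F h1 h2 h3 c1 c2) (comult C c)) (comult H h'))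
        (comult H h)"
    by (simp add: tlift_swap[of _ _ "comult C c"])
  also have "\<dots> = tlift (\<lambda>h' h3. tlift (\<lambda>h1 h2. tlift (\<lambda>c1 c2. ?F h1 h2 h3 c1 c2) (comult C c))
      (comult H h')) (comult H h)"
    by (rule coassociativity[OF coalgebra_H, symmetric]) (intro multilinearI clin lin)+
  also have "\<dots> = diag_sum H C (c # ys) G h"
    by (simp add: G tlift_comult_lact[OF bil] tlift_diag_sum)
  finally show ?case by simp
next
  case (Cons x xs)
  note lin = clinear_multilinear[OF Cons.prems(1)]
  have "tlift (\<lambda>c1 c2. diag_sum H C (xs @ c1 # c2 # ys) (\<lambda>ds. F (lact C h1 x # ds)) h2) (comult C c)
     = diag_sum H C (xs @ c # ys) (\<lambda>ds. G (lact C h1 x # ds)) h2" for h1 h2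
    by (rule Cons.IH) (intro multilinearI lin clin, simp add: Cons.prems(2)[of "_ # _", simplified])
  then show ?case
    by (simp add: tlift_swap[of _ _ "comult C c"])
qed

text \<open>
  The same for deleting an entry, because \<open>\<epsilon>(hc) = \<epsilon>(h)\<epsilon>(c)\<close> and the factor of \<open>h\<close> that acts
  on the deleted entry is absorbed by the counit.
\<close>

lemma diag_sum_counit:
  fixes F :: "'c list \<Rightarrow> 'v::complex_vector"
  assumes "multilinear F"
    and "\<And>us d vs. length us = length xs \<Longrightarrow> G (us @ d # vs) = counit C d *\<^sub>C F (us @ vs)"
  shows "counit C c *\<^sub>C diag_sum H C (xs @ ys) F h = diag_sum H C (xs @ c # ys) G h"
  using assms
proof (induction xs arbitrary: F G h)
  case Nil
  have G: "G (d # vs) = counit C d *\<^sub>C F vs" for d vs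
    using Nil.prems(2)[of "[]"] by simp
  have sc: "clinear (\<lambda>x::'v. r *\<^sub>C x)" for r by (intro clin)
  have "diag_sum H C (c # ys) G h
    = tlift (\<lambda>h1 h2. counit H h1 *\<^sub>C (counit C c *\<^sub>C diag_sum H C ys F h2)) (comult H h)"
    by (simp add: G counit_lact diag_sum_linear[OF sc, symmetric] scaleC_scaleC)
  also have "\<dots> = counit C c *\<^sub>C diag_sum H C ys F h"
    by (rule counit_left[OF coalgebra_H]) (intro clin Nil.prems(1))
  finally show ?case by simp
next
  case (Cons x xs)
  note lin = clinear_multilinear[OF Cons.prems(1)]
  have sc: "clinear (\<lambda>x::'v. r *\<^sub>C x)" for r by (intro clin)
  have "counit C c *\<^sub>C diag_sum H C (xs @ ys) (\<lambda>ds. F (lact C h1 x # ds)) h2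
     = diag_sum H C (xs @ c # ys) (\<lambda>ds. G (lact C h1 x # ds)) h2" for h1 h2
    by (rule Cons.IH) (intro multilinearI lin clin, simp add: Cons.prems(2)[of "_ # _", simplified])
  then show ?case
    by (simp add: tlift_linear[OF sc])
qed

end

section \<open>Quotient spaces\<close>

lemma coset_eq_iff:
  assumes "complex_vector.subspace B"
  shows "coset B x = coset B y \<longleftrightarrow> x - y \<in> B"
proof
  assume "coset B x = coset B y"
  moreover have "x \<in> coset B x"
    unfolding coset_def using complex_vector.subspace_0[OF assms] by force
  ultimately show "x - y \<in> B" by (auto simp: coset_def)
next
  assume *: "x - y \<in> B"
  have "x + b \<in> coset B y" if "b \<in> B" for b
    unfolding coset_def using complex_vector.subspace_add[OF assms * that]
    by (auto intro!: exI[of _ "x - y + b"])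
  moreover have "y + b \<in> coset B x" if "b \<in> B" for b
    unfolding coset_def using complex_vector.subspace_diff[OF assms that *]
    by (auto intro!: exI[of _ "b - (x - y)"])
  ultimately show "coset B x = coset B y"
    unfolding coset_def by blast
qed

lemma coset_add:
  assumes "complex_vector.subspace B"
  shows "{u + v | u v. u \<in> coset B x \<and> v \<in> coset B y} = coset B (x + y)"
proof -
  have "x + b + (y + b') = x + y + (b + b')" for b b' by simp
  moreover have "x + y + b = x + b + (y + 0)" for b by simp
  ultimately show ?thesis
    unfolding coset_def
    using complex_vector.subspace_add[OF assms] complex_vector.subspace_0[OF assms] by blast
qed

lemma coset_scale:
  assumes "complex_vector.subspace B"
  shows "{a *\<^sub>C u + b | u b. u \<in> coset B x \<and> b \<in> B} = coset B (a *\<^sub>C x)"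
proof -
  have "a *\<^sub>C (x + b) + b' = a *\<^sub>C x + (a *\<^sub>C b + b')" for b b'
    by (simp add: scaleC_add_right)
  moreover have "a *\<^sub>C x + b = a *\<^sub>C (x + 0) + b" for b by simp
  ultimately show ?thesis
    unfolding coset_def
    using complex_vector.subspace_add[OF assms] complex_vector.subspace_0[OF assms]
      complex_vector.subspace_scale[OF assms] by blast
qed

lemma quotient_space_simps:
  assumes "complex_vector.subspace B"
  shows "carrier (quotient_space A B) = coset B ` A"
    and "coset B x \<oplus>\<^bsub>quotient_space A B\<^esub> coset B y = coset B (x + y)"
    and "a \<odot>\<^bsub>quotient_space A B\<^esub> coset B x = coset B (a *\<^sub>C x)"
    and "\<zero>\<^bsub>quotient_space A B\<^esub> = coset B 0"
  using coset_add[OF assms] coset_scale[OF assms]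
  by (simp_all add: quotient_space_def coset_def)

lemma module_quotient_space:
  assumes A: "complex_vector.subspace A" and B: "complex_vector.subspace B"
  shows "Module.module (ring_of_type_algebra :: complex ring) (quotient_space A B)"
proof (rule moduleI)
  note simps = quotient_space_simps[OF B]
  note closed = complex_vector.subspace_add[OF A] complex_vector.subspace_scale[OF A]
    complex_vector.subspace_0[OF A] complex_vector.subspace_neg[OF A]
  show "cring (ring_of_type_algebra :: complex ring)"
    by (rule cring_from_type_algebra)
  show "abelian_group (quotient_space A B)"
  proof (rule abelian_groupI)
    fix x assume "x \<in> carrier (quotient_space A B)"
    then obtain v where v: "v \<in> A" "x = coset B v" by (auto simp: simps)
    with closed(4) have "coset B (- v) \<in> carrier (quotient_space A B)" by (simp add: simps)
    then show "\<exists>y\<in>carrier (quotient_space A B). y \<oplus>\<^bsub>quotient_space A B\<^esub> x = \<zero>\<^bsub>quotient_space A B\<^esub>"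
      by (rule bexI[rotated]) (simp add: v simps)
  qed (auto simp: simps closed add_ac)
qed (auto simp: quotient_space_simps[OF B] ring_of_type_algebra_def
    complex_vector.subspace_scale[OF A]
    scaleC_add_left scaleC_add_right scaleC_scaleC scaleC_one)

text \<open>
  \<open>induced\<close> is a union over a coset; all its members coincide as soon as \<open>f\<close> maps \<open>B\<close> into
  \<open>B'\<close>.
\<close>

lemma induced_coset:
  assumes f: "clinear f" and B': "complex_vector.subspace B'" and B: "complex_vector.subspace B"
    and fB: "\<And>b. b \<in> B \<Longrightarrow> f b \<in> B'"
  shows "induced B' f (coset B x) = coset B' (f x)"
proof -
  have "coset B' (f (x + b)) = coset B' (f x)" if "b \<in> B" for b
    unfolding coset_eq_iff[OF B'] using fB[OF that] by (simp add: clinear_plus[OF f])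
  then show ?thesis
    using complex_vector.subspace_0[OF B] by (auto simp: induced_def coset_def[of B])
qed

lemma module_map_induced:
  assumes f: "clinear f" and B': "complex_vector.subspace B'" and B: "complex_vector.subspace B"
    and fB: "\<And>b. b \<in> B \<Longrightarrow> f b \<in> B'" and fA: "\<And>a. a \<in> A \<Longrightarrow> f a \<in> A'"
  shows "module_map R (quotient_space A B) (quotient_space A' B') (induced B' f)"
  using fA unfolding module_map_def
  by (auto simp: quotient_space_simps[OF B] quotient_space_simps[OF B'] induced_coset[OF f B' B fB]
      clinear_simps[OF f])

lemma descends_linear:
  assumes f: "clinear f" and B': "complex_vector.subspace B'" and B: "complex_vector.subspace B"
    and fB: "\<And>b. b \<in> B \<Longrightarrow> f b \<in> B'" and fA: "\<And>a. a \<in> A \<Longrightarrow> f a \<in> A'"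
  shows "descends A B A' B' f"
  unfolding descends_def coset_eq_iff[OF B] coset_eq_iff[OF B']
  using fA fB by (auto simp: clinear_minus[OF f, symmetric])


section \<open>Values of the operators on pure tensors\<close>

context hopf_coefficients
begin

text \<open>
  Linearity in a slot of \<open>cs\<close> is checked separately for the comultiplied slot and for the
  slots before and after it. The pure value is stated for a list split at position \<open>i\<close>, the
  form in which the identities are computed.
\<close>

lemma coface_linear_and_pure:
  assumes "i \<le> n"
  shows clinear_coface_inner: "clinear (coface C M n i)"
    and coface_pure: "\<lbrakk>length xs = i; i + length ys = n\<rbrakk> \<Longrightarrow>
      coface C M n i (m \<otimes>\<^sub>C tp (xs @ c # ys)) =
        tlift (\<lambda>c1 c2. m \<otimes>\<^sub>C tp (xs @ c1 # c2 # ys)) (comult C c)"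
proof -
  let ?f = "\<lambda>(m :: 'm) cs. tlift (\<lambda>c1 c2. m \<otimes>\<^sub>C tp (take i cs @ [c1, c2] @ drop (i + 1) cs))
      (comult C (cs ! i))"
  have coface: "coface C M n i = MC_lift (n + 1) ?f"
    using assms by (simp add: coface_def)
  have mult: "clinear (\<lambda>a. ?f m (us @ a # vs))" if len: "length us + length vs + 1
      = n + 1" for m us vs
  proof -
    consider "i = length us" | "i < length us" | "length us < i" by linarith
    then show ?thesis
    proof cases
      case 1
      then show ?thesis by simp (intro clin)
    next
      case 2
      then obtain p q r where [simp]: "us = p @ q # r" "i = length p"
        by (elim list_split_nth) auto
      show ?thesis by simp (intro clin)
    next
      case 3
      with len assms have "i - length us - 1 < length vs" by linarith
      then obtain p q r where [simp]: "vs = p @ q # r" and "length p = i - length us - 1"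
        by (elim list_split_nth) auto
      with 3 have [simp]: "i = length us + Suc (length p)" by linarith
      show ?thesis by (simp add: nth_append) (intro clin)
    qed
  qed
  have lin: "clinear (\<lambda>m. ?f m cs)" for cs by (intro clin)
  show "clinear (coface C M n i)"
    unfolding coface by (rule clinear_MC_lift[OF mult lin])
  show "coface C M n i (m \<otimes>\<^sub>C tp (xs @ c # ys)) =
      tlift (\<lambda>c1 c2. m \<otimes>\<^sub>C tp (xs @ c1 # c2 # ys)) (comult C c)"
    if "length xs = i" "i + length ys = n"
    unfolding coface using that by (subst MC_lift_pure[OF mult lin]) auto
qed

lemma codegeneracy_linear_and_pure:
  assumes "i < n"
  shows clinear_codegeneracy: "clinear (codegeneracy C n i :: ('m, 'c tpow) tensor \<Rightarrow> _)"
    and codegeneracy_pure: "\<lbrakk>length xs = i + 1; i + 1 + length ys = n\<rbrakk> \<Longrightarrow>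
      codegeneracy C n i ((m :: 'm) \<otimes>\<^sub>C tp (xs @ c # ys)) = counit C c *\<^sub>C (m \<otimes>\<^sub>C tp (xs @ ys))"
proof -
  let ?f = "\<lambda>(m :: 'm) cs. counit C (cs ! (i + 1)) *\<^sub>C (m \<otimes>\<^sub>C tp (take (i + 1) cs @ drop (i + 2) cs))"
  have mult: "clinear (\<lambda>a. ?f m (us @ a # vs))" if len: "length us + length vs + 1
      = n + 1" for m us vs
  proof -
    consider "i + 1 = length us" | "i + 1 < length us" | "length us < i + 1" by linarith
    then show ?thesis
    proof cases
      case 1
      then have [simp]: "Suc i = length us" by simp
      show ?thesis by simp (intro clin)
    next
      case 2
      then obtain p q r where [simp]: "us = p @ q # r" "Suc i = length p"
        by (elim list_split_nth) auto
      show ?thesis by simp (intro clin)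
    next
      case 3
      with len assms have "i - length us < length vs" by linarith
      then obtain p q r where [simp]: "vs = p @ q # r" and "length p = i - length us"
        by (elim list_split_nth) auto
      with 3 have [simp]: "i = length us + length p" by linarith
      show ?thesis by (simp add: nth_append) (intro clin)
    qed
  qed
  have lin: "clinear (\<lambda>m. ?f m cs)" for cs by (intro clin)
  show "clinear (codegeneracy C n i :: ('m, 'c tpow) tensor \<Rightarrow> _)"
    unfolding codegeneracy_def by (rule clinear_MC_lift[OF mult lin])
  show "codegeneracy C n i (m \<otimes>\<^sub>C tp (xs @ c # ys)) = counit C c *\<^sub>C (m \<otimes>\<^sub>C tp (xs @ ys))"
    if "length xs = i + 1" "i + 1 + length ys = n"
    unfolding codegeneracy_def using that by (subst MC_lift_pure[OF mult lin])
        (auto simp: nth_append)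
qed

lemma cyclic_op_linear_and_pure:
  shows clinear_cyclic_op: "clinear (cyclic_op C M n)"
    and cyclic_op_pure: "length cs = n \<Longrightarrow>
      cyclic_op C M n (m \<otimes>\<^sub>C tp (c # cs)) = tlift (\<lambda>x m0. m0 \<otimes>\<^sub>C tp (cs @ [lact C x c])) (coact M m)"
proof -
  let ?f = "\<lambda>(m :: 'm) cs. tlift (\<lambda>x m0. m0 \<otimes>\<^sub>C tp (tl cs @ [lact C x (hd cs)])) (coact M m)"
  have mult: "clinear (\<lambda>a. ?f m (us @ a # vs))" for m us vs
    by (cases us; simp; intro clin)
  have lin: "clinear (\<lambda>m. ?f m cs)" for cs by (intro clin)
  show "clinear (cyclic_op C M n)"
    unfolding cyclic_op_def by (rule clinear_MC_lift[OF mult lin])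
  show "cyclic_op C M n (m \<otimes>\<^sub>C tp (c # cs)) = tlift (\<lambda>x m0. m0 \<otimes>\<^sub>C tp (cs @ [lact C x c]))
      (coact M m)"
    if "length cs = n"
    unfolding cyclic_op_def using that by (subst MC_lift_pure[OF mult lin]) auto
qed

lemma coface_last_linear_and_pure:
  shows clinear_coface_last: "clinear (coface C M n (n + 1))"
    and coface_last_pure: "length cs = n \<Longrightarrow>
      coface C M n (n + 1) (m \<otimes>\<^sub>C tp (c # cs)) =
        tlift (\<lambda>x m0. tlift (\<lambda>c1 c2. m0 \<otimes>\<^sub>C tp (c2 # cs @ [lact C x c1])) (comult C c)) (coact M m)"
proof -
  let ?f = "\<lambda>(m :: 'm) cs. tlift (\<lambda>x m0. tlift (\<lambda>c1 c2. m0 \<otimes>\<^sub>C tp ([c2] @ tl cs @ [lact C x c1]))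
        (comult C (hd cs))) (coact M m)"
  have coface: "coface C M n (n + 1) = MC_lift (n + 1) ?f"
    by (simp add: coface_def)
  have mult: "clinear (\<lambda>a. ?f m (us @ a # vs))" for m us vs
    by (cases us; simp; intro clin)
  have lin: "clinear (\<lambda>m. ?f m cs)" for cs by (intro clin)
  show "clinear (coface C M n (n + 1))"
    unfolding coface by (rule clinear_MC_lift[OF mult lin])
  show "coface C M n (n + 1) (m \<otimes>\<^sub>C tp (c # cs)) =
      tlift (\<lambda>x m0. tlift (\<lambda>c1 c2. m0 \<otimes>\<^sub>C tp (c2 # cs @ [lact C x c1])) (comult C c)) (coact M m)"
    if "length cs = n"
    unfolding coface using that by (subst MC_lift_pure[OF mult lin]) auto
qed

lemma clinear_coface: "i \<le> n + 1 \<Longrightarrow> clinear (coface C M n i)"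
  using clinear_coface_inner clinear_coface_last by (cases "i \<le> n") (auto simp: le_Suc_eq)

lemma cyclic_op_MC_space:
  assumes "v \<in> MC_space (n + 1)"
  shows "cyclic_op C M n v \<in> MC_space (n + 1)"
  using clinear_cyclic_op assms
proof (rule MC_space_image)
  fix m :: 'm and cs :: "'c list"
  assume "length cs = n + 1"
  then show "cyclic_op C M n (m \<otimes>\<^sub>C tp cs) \<in> MC_space (n + 1)"
    by (cases cs) (auto simp: cyclic_op_pure intro!: tlift_in_MC_space MC_space_pure)
qed

lemma codegeneracy_MC_space:
  assumes "i < n" and "(v :: ('m, 'c tpow) tensor) \<in> MC_space (n + 1)"
  shows "codegeneracy C n i v \<in> MC_space n"
  using clinear_codegeneracy[OF assms(1)] assms(2)
proof (rule MC_space_image)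
  fix m :: 'm and cs :: "'c list"
  assume *: "length cs = n + 1"
  with assms(1) have "i + 1 < length cs" by simp
  then obtain xs c ys where "cs = xs @ c # ys" "length xs = i + 1"
    by (rule list_split_nth)
  with * show "codegeneracy C n i (m \<otimes>\<^sub>C tp cs) \<in> MC_space n"
    using assms(1) unfolding MC_space_def
    by (auto simp: codegeneracy_pure MC_space_pure[unfolded MC_space_def]
        intro!: complex_vector.span_scale)
qed

lemma coface_inner_MC_space:
  assumes "i \<le> n" and "v \<in> MC_space (n + 1)"
  shows "coface C M n i v \<in> MC_space (n + 2)"
  using clinear_coface_inner[OF assms(1)] assms(2)
proof (rule MC_space_image)
  fix m :: 'm and cs :: "'c list"
  assume *: "length cs = n + 1"
  with assms(1) have "i < length cs" by simp
  then obtain xs c ys where "cs = xs @ c # ys" "length xs = i"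
    by (rule list_split_nth)
  with * assms(1) show "coface C M n i (m \<otimes>\<^sub>C tp cs) \<in> MC_space (n + 2)"
    by (auto simp: coface_pure intro!: tlift_in_MC_space MC_space_pure)
qed


section \<open>The identities that hold before dividing by the action\<close>

text \<open>
  This identity reduces statements about the last coface to the inner coface \<open>\<partial>\<^sub>0\<close> and \<open>\<tau>\<close>.
\<close>

lemma cyclic_coface_first:
  assumes "v \<in> MC_space (n + 1)"
  shows "cyclic_op C M (n + 1) (coface C M n 0 v) = coface C M n (n + 1) v"
  using assms
proof (rule MC_space_ext[rotated 2])
  show "clinear (\<lambda>v. cyclic_op C M (n + 1) (coface C M n 0 v))"
    by (intro clinear_compose[OF clinear_cyclic_op] clinear_coface) simp
  show "clinear (coface C M n (n + 1))" by (rule clinear_coface_last)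
  fix m :: 'm and cs :: "'c list"
  assume "length cs = n + 1"
  then obtain c cs' where cs: "cs = c # cs'" and len: "length cs' = n"
    by (cases cs) auto
  show "cyclic_op C M (n + 1) (coface C M n 0 (m \<otimes>\<^sub>C tp cs)) = coface C M n (n + 1) (m \<otimes>\<^sub>C tp cs)"
    unfolding cs coface_last_pure[OF len] using coface_pure[of 0 n "[]" cs' m c] len
    by (simp add: tlift_linear[OF clinear_cyclic_op] cyclic_op_pure tlift_swap[of _ _ "comult C c"])
qed

lemma coface_last_MC_space:
  "v \<in> MC_space (n + 1) \<Longrightarrow> coface C M n (n + 1) v \<in> MC_space (n + 2)"
  using cyclic_op_MC_space[of "coface C M n 0 v" "n + 1"] coface_inner_MC_space[of 0 n v]
    cyclic_coface_first[of v n]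
  by simp

lemma coface_MC_space:
  "i \<le> n + 1 \<Longrightarrow> v \<in> MC_space (n + 1) \<Longrightarrow> coface C M n i v \<in> MC_space (n + 2)"
  using coface_inner_MC_space coface_last_MC_space by (cases "i \<le> n") (auto simp: le_Suc_eq)

lemma cyclic_coface_inner:
  assumes "1 \<le> i" "i \<le> n" and "v \<in> MC_space (n + 1)"
  shows "cyclic_op C M (n + 1) (coface C M n i v) = coface C M n (i - 1) (cyclic_op C M n v)"
  using assms(3)
proof (rule MC_space_ext[rotated 2])
  show "clinear (\<lambda>v. cyclic_op C M (n + 1) (coface C M n i v))"
    using assms by (intro clinear_compose[OF clinear_cyclic_op] clinear_coface) simp
  have lin: "clinear (coface C M n (i - 1))"
    using assms by (intro clinear_coface) simp
  show "clinear (\<lambda>v. coface C M n (i - 1) (cyclic_op C M n v))"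
    by (intro clinear_compose[OF lin] clinear_cyclic_op)
  fix m :: 'm and cs :: "'c list"
  assume "length cs = n + 1"
  then obtain b cs' where "cs = b # cs'" and "length cs' = n"
    by (cases cs) auto
  moreover from this assms have "i - 1 < length cs'" by simp
  then obtain xs c ys where "cs' = xs @ c # ys" "length xs = i - 1"
    by (rule list_split_nth)
  ultimately have cs: "cs = b # xs @ c # ys" and len: "length xs = i - 1" "i + length ys = n"
    using assms by auto
  show "cyclic_op C M (n + 1) (coface C M n i (m \<otimes>\<^sub>C tp cs))
      = coface C M n (i - 1) (cyclic_op C M n (m \<otimes>\<^sub>C tp cs))"
    unfolding cs using coface_pure[of i n "b # xs" ys m c] len assms
    by (simp add: tlift_linear[OF clinear_cyclic_op] tlift_linear[OF lin, simplified] cyclic_op_pure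
        coface_pure tlift_swap[of _ _ "comult C c"])
qed

text \<open>
  Both sides are \<open>m\<^sub>0 \<otimes> cs' \<otimes> m\<^sub>-\<^sub>2c\<^sup>(\<^sup>1\<^sup>) \<otimes> m\<^sub>-\<^sub>1c\<^sup>(\<^sup>2\<^sup>)\<close>: on the left from two successive coactions, on
  the right from the coproduct of \<open>m\<^sub>-\<^sub>1c\<close>.
\<close>

lemma cyclic_coface_last:
  assumes "v \<in> MC_space (n + 1)"
  shows "cyclic_op C M (n + 1) (coface C M n (n + 1) v) = coface C M n n (cyclic_op C M n v)"
  using assms
proof (rule MC_space_ext[rotated 2])
  show "clinear (\<lambda>v. cyclic_op C M (n + 1) (coface C M n (n + 1) v))"
    by (intro clinear_compose[OF clinear_cyclic_op] clinear_coface) simp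
  have lin: "clinear (coface C M n n)"
    by (intro clinear_coface) simp
  show "clinear (\<lambda>v. coface C M n n (cyclic_op C M n v))"
    by (intro clinear_compose[OF lin] clinear_cyclic_op)
  fix m :: 'm and cs :: "'c list"
  assume "length cs = n + 1"
  then obtain c cs' where cs: "cs = c # cs'" and len: "length cs' = n"
    by (cases cs) auto
  let ?F = "\<lambda>x y m0. tlift (\<lambda>c1 c2. m0 \<otimes>\<^sub>C tp (cs' @ [lact C x c1, lact C y c2])) (comult C c)"
  have "cyclic_op C M (n + 1) (coface C M n (n + 1) (m \<otimes>\<^sub>C tp cs))
    = tlift (\<lambda>x m0. tlift (\<lambda>y m1. ?F x y m1) (coact M m0)) (coact M m)"
    unfolding cs coface_last_pure[OF len] using len
    by (simp add: tlift_linear[OF clinear_cyclic_op] cyclic_op_pure tlift_swap[of _ _ "comult C c"])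
  also have "\<dots> = tlift (\<lambda>x m0. tlift (\<lambda>x1 x2. ?F x1 x2 m0) (comult H x)) (coact M m)"
    by (rule coaction_coassociativity) (intro clin)+
  also have "\<dots> = coface C M n n (cyclic_op C M n (m \<otimes>\<^sub>C tp cs))"
  proof -
    have bil: "cbilinear (\<lambda>c1 c2. m0 \<otimes>\<^sub>C tp (cs' @ c1 # c2 # []))" for m0 :: 'm
      by (intro clin)
    have "coface C M n n (m0 \<otimes>\<^sub>C tp (cs' @ [lact C x c]))
        = tlift (\<lambda>x1 x2. ?F x1 x2 m0) (comult H x)" for x m0
      using coface_pure[of n n cs' "[]" m0 "lact C x c"] len by
          (simp add: tlift_comult_lact[OF bil])
    then show ?thesis
      unfolding cs cyclic_op_pure[OF len] by (simp add: tlift_linear[OF lin])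
  qed
  finally show "cyclic_op C M (n + 1) (coface C M n (n + 1) (m \<otimes>\<^sub>C tp cs))
    = coface C M n n (cyclic_op C M n (m \<otimes>\<^sub>C tp cs))" .
qed

lemma cyclic_coface:
  assumes "1 \<le> i" "i \<le> n + 1" and "v \<in> MC_space (n + 1)"
  shows "cyclic_op C M (n + 1) (coface C M n i v) = coface C M n (i - 1) (cyclic_op C M n v)"
  using cyclic_coface_inner[OF assms(1) _ assms(3)] cyclic_coface_last[OF assms(3)] assms(2)
  by (cases "i \<le> n") (auto simp: le_Suc_eq)

lemma cyclic_codegeneracy:
  assumes "1 \<le> i" "i \<le> n" and "v \<in> MC_space (n + 2)"
  shows "cyclic_op C M n (codegeneracy C (n + 1) i v)
      = codegeneracy C (n + 1) (i - 1) (cyclic_op C M (n + 1) v)"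
  using assms(3)
proof (rule MC_space_ext[rotated 2])
  show "clinear (\<lambda>v. cyclic_op C M n (codegeneracy C (n + 1) i v))"
    using assms by (intro clinear_compose[OF clinear_cyclic_op] clinear_codegeneracy) simp
  have lin: "clinear (codegeneracy C (n + 1) (i - 1) :: ('m, 'c tpow) tensor \<Rightarrow> _)"
    using assms by (intro clinear_codegeneracy) simp
  show "clinear (\<lambda>v. codegeneracy C (n + 1) (i - 1) (cyclic_op C M (n + 1) v))"
    by (intro clinear_compose[OF lin] clinear_cyclic_op)
  fix m :: 'm and cs :: "'c list"
  assume "length cs = n + 2"
  then obtain b cs' where "cs = b # cs'" and "length cs' = n + 1"
    by (cases cs) auto
  moreover from this assms have "i < length cs'" by simp
  then obtain xs c ys where "cs' = xs @ c # ys" "length xs = i"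
    by (rule list_split_nth)
  ultimately have cs: "cs = b # xs @ c # ys" and len: "length xs = i" "i + length ys = n"
    using assms by auto
  have "cyclic_op C M n (codegeneracy C (n + 1) i (m \<otimes>\<^sub>C tp cs))
    = counit C c *\<^sub>C tlift (\<lambda>x m0. m0 \<otimes>\<^sub>C tp (xs @ ys @ [lact C x b])) (coact M m)"
    unfolding cs using codegeneracy_pure[of i "n + 1" "b # xs" ys m c] len assms
    by (simp add: clinear_scaleC[OF clinear_cyclic_op] cyclic_op_pure)
  also have "\<dots> = tlift (\<lambda>x m0. counit C c *\<^sub>C (m0 \<otimes>\<^sub>C tp (xs @ ys @ [lact C x b]))) (coact M m)"
    by (rule tlift_linear) (intro clin)
  also have "\<dots> = codegeneracy C (n + 1) (i - 1) (cyclic_op C M (n + 1) (m \<otimes>\<^sub>C tp cs))"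
    unfolding cs using len assms
    by (simp add: tlift_linear[OF lin, simplified] cyclic_op_pure codegeneracy_pure)
  finally show "cyclic_op C M n (codegeneracy C (n + 1) i (m \<otimes>\<^sub>C tp cs))
    = codegeneracy C (n + 1) (i - 1) (cyclic_op C M (n + 1) (m \<otimes>\<^sub>C tp cs))" .
qed

text \<open>
  The second rotation moves the entry to be deleted to the end, where it carries a factor
  \<open>\<epsilon>(m\<^sub>-\<^sub>1)\<close>; the counit axiom of the coaction removes that factor.
\<close>

lemma cyclic_codegeneracy_first:
  assumes "v \<in> MC_space (n + 2)"
  shows "cyclic_op C M n (codegeneracy C (n + 1) 0 v)
    = codegeneracy C (n + 1) n (cyclic_op C M (n + 1) (cyclic_op C M (n + 1) v))"
  using assms
proof (rule MC_space_ext[rotated 2])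
  show "clinear (\<lambda>v. cyclic_op C M n (codegeneracy C (n + 1) 0 v))"
    by (intro clinear_compose[OF clinear_cyclic_op] clinear_codegeneracy) simp
  have lin: "clinear (codegeneracy C (n + 1) n :: ('m, 'c tpow) tensor \<Rightarrow> _)"
    by (intro clinear_codegeneracy) simp
  show "clinear (\<lambda>v. codegeneracy C (n + 1) n (cyclic_op C M (n + 1) (cyclic_op C M (n + 1) v)))"
    by (intro clinear_compose[OF lin] clinear_compose[OF clinear_cyclic_op] clinear_cyclic_op)
  fix m :: 'm and cs :: "'c list"
  assume "length cs = n + 2"
  then obtain b c ys where cs: "cs = b # c # ys" and len: "length ys = n"
    by (auto simp: length_Suc_conv)
  have "codegeneracy C (n + 1) n (m1 \<otimes>\<^sub>C tp ((ys @ [lact C x b]) @ [lact C y c]))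
     = counit H y *\<^sub>C (counit C c *\<^sub>C (m1 \<otimes>\<^sub>C tp (ys @ [lact C x b])))" for m1 :: 'm and x y
    by (subst codegeneracy_pure) (simp_all add: len counit_lact scaleC_scaleC)
  then have "codegeneracy C (n + 1) n (cyclic_op C M (n + 1) (cyclic_op C M (n + 1) (m \<otimes>\<^sub>C tp cs)))
    = tlift (\<lambda>x m0. tlift (\<lambda>y m1. counit H y *\<^sub>C (counit C c *\<^sub>C (m1 \<otimes>\<^sub>C tp (ys @ [lact C x b]))))
        (coact M m0)) (coact M m)"
    unfolding cs using len
    by (simp add: tlift_linear[OF lin, simplified] tlift_linear[OF clinear_cyclic_op]
        cyclic_op_pure)
  also have "\<dots> = tlift (\<lambda>x m0. counit C c *\<^sub>C (m0 \<otimes>\<^sub>C tp (ys @ [lact C x b]))) (coact M m)"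
  proof -
    have "tlift (\<lambda>y m1. counit H y *\<^sub>C (counit C c *\<^sub>C (m1 \<otimes>\<^sub>C tp (ys @ [lact C x b])))) (coact M m0)
       = counit C c *\<^sub>C (m0 \<otimes>\<^sub>C tp (ys @ [lact C x b]))" for x m0
      by (rule coaction_counit) (intro clin)
    then show ?thesis by simp
  qed
  also have "\<dots> = counit C c *\<^sub>C tlift (\<lambda>x m0. m0 \<otimes>\<^sub>C tp (ys @ [lact C x b])) (coact M m)"
    by (rule tlift_linear[symmetric]) (intro clin)
  also have "\<dots> = cyclic_op C M n (codegeneracy C (n + 1) 0 (m \<otimes>\<^sub>C tp cs))"
    unfolding cs using codegeneracy_pure[of 0 "n + 1" "[b]" ys m c] len
    by (simp add: clinear_scaleC[OF clinear_cyclic_op] cyclic_op_pure)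
  finally show "cyclic_op C M n (codegeneracy C (n + 1) 0 (m \<otimes>\<^sub>C tp cs))
    = codegeneracy C (n + 1) n (cyclic_op C M (n + 1) (cyclic_op C M (n + 1) (m \<otimes>\<^sub>C tp cs)))" by simp
qed

text \<open>
  Adjacent positions need coassociativity of \<open>C\<close>; for distant ones the two coproducts are
  taken in different entries and the sums are interchanged.
\<close>

lemma coface_coface_inner:
  assumes "i < j" "j \<le> n + 1" and "v \<in> MC_space (n + 1)"
  shows "coface C M (n + 1) j (coface C M n i v) = coface C M (n + 1) i (coface C M n (j - 1) v)"
  using assms(3)
proof (rule MC_space_ext[rotated 2])
  have lin: "clinear (coface C M (n + 1) j)" "clinear (coface C M (n + 1) i)"
    using assms by (simp_all add: clinear_coface)
  show "clinear (\<lambda>v. coface C M (n + 1) j (coface C M n i v))"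
    "clinear (\<lambda>v. coface C M (n + 1) i (coface C M n (j - 1) v))"
    using assms by (intro clinear_compose[OF lin(1)] clinear_compose[OF lin(2)] clinear_coface;
        simp)+
  note push = tlift_linear[OF lin(1), simplified] tlift_linear[OF lin(2), simplified]
  fix m :: 'm and cs :: "'c list"
  assume len: "length cs = n + 1"
  show "coface C M (n + 1) j (coface C M n i (m \<otimes>\<^sub>C tp cs))
      = coface C M (n + 1) i (coface C M n (j - 1) (m \<otimes>\<^sub>C tp cs))"
  proof (cases "j = i + 1")
    case True
    note push = push tlift_linear[OF lin(1)[unfolded True], simplified]
    from len assms have "i < length cs" by simp
    then obtain xs c ys where cs: "cs = xs @ c # ys" "length xs = i"
      by (rule list_split_nth)
    have "coface C M (n + 1) j (coface C M n i (m \<otimes>\<^sub>C tp cs))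
      = tlift (\<lambda>c1 c'. tlift (\<lambda>c2 c3. m \<otimes>\<^sub>C tp (xs @ c1 # c2 # c3 # ys)) (comult C c')) (comult C c)"
      using True len assms cs coface_pure[of j "n + 1" "xs @ [c1]" ys m c' for c1 c']
      by (simp add: coface_pure push)
    also have "\<dots> = tlift (\<lambda>c' c3. tlift (\<lambda>c1 c2. m \<otimes>\<^sub>C tp (xs @ c1 # c2 # c3 # ys)) (comult C c'))
        (comult C c)"
      by (rule coassociativity[OF coalgebra_C, symmetric]) (intro clin)+
    also have "\<dots> = coface C M (n + 1) i (coface C M n (j - 1) (m \<otimes>\<^sub>C tp cs))"
      using True len assms cs by (simp add: coface_pure push)
    finally show ?thesis .
  next
    case False
    with len assms have "i < j - 1" "j - 1 < length cs" by simp_all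
    then obtain xs c ys d zs where cs: "cs = xs @ c # ys @ d # zs" "length xs = i"
        "length ys = j - 1 - i - 1"
      by (rule list_split_nth2)
    then have "coface C M (n + 1) j (coface C M n i (m \<otimes>\<^sub>C tp cs))
      = tlift (\<lambda>c1 c2. tlift (\<lambda>d1 d2. m \<otimes>\<^sub>C tp (xs @ c1 # c2 # ys @ d1 # d2 # zs)) (comult C d))
          (comult C c)"
      using False len assms coface_pure[of j "n + 1" "xs @ c1 # c2 # ys" zs m d for c1 c2]
      by (simp add: coface_pure push)
    also have "\<dots> = tlift (\<lambda>d1 d2. tlift (\<lambda>c1 c2. m \<otimes>\<^sub>C tp (xs @ c1 # c2 # ys @ d1 # d2 # zs))
        (comult C c)) (comult C d)"
      by (rule tlift_swap)
    also have "\<dots> = coface C M (n + 1) i (coface C M n (j - 1) (m \<otimes>\<^sub>C tp cs))"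
      using cs False len assms coface_pure[of "j - 1" n "xs @ c # ys" zs m d]
      by (simp add: coface_pure push)
    finally show ?thesis .
  qed
qed

text \<open>
  For \<open>j = n + 2\<close> the outer coface is \<open>\<tau> \<partial>\<^sub>0\<close>. If \<open>i \<le> n\<close>, then \<open>\<tau> \<partial>\<^sub>0 \<partial>\<^sub>i = \<tau> \<partial>\<^sub>i\<^sub>+\<^sub>1 \<partial>\<^sub>0 = \<partial>\<^sub>i \<tau> \<partial>\<^sub>0
  = \<partial>\<^sub>i \<partial>\<^sub>n\<^sub>+\<^sub>1\<close>. If \<open>i = n + 1\<close>, the case \<open>i = 0\<close> just obtained gives \<open>\<tau> \<partial>\<^sub>0 \<partial>\<^sub>n\<^sub>+\<^sub>1 = \<tau> \<partial>\<^sub>n\<^sub>+\<^sub>2 \<partial>\<^sub>0 =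
  \<partial>\<^sub>n\<^sub>+\<^sub>1 \<tau> \<partial>\<^sub>0 = \<partial>\<^sub>n\<^sub>+\<^sub>1 \<partial>\<^sub>n\<^sub>+\<^sub>1\<close>.
\<close>

lemma coface_coface:
  assumes "i < j" "j \<le> n + 2" and v: "v \<in> MC_space (n + 1)"
  shows "coface C M (n + 1) j (coface C M n i v) = coface C M (n + 1) i (coface C M n (j - 1) v)"
proof -
  have d0: "coface C M n 0 v \<in> MC_space (n + 2)" by (rule coface_MC_space[OF _ v]) simp
  have last: "coface C M (n + 1) (n + 2) (coface C M n i v)
      = coface C M (n + 1) i (coface C M n (n + 1) v)"
    if i: "i \<le> n" for i
  proof -
    have "coface C M (n + 1) (n + 2) (coface C M n i v)
        = cyclic_op C M (n + 2) (coface C M (n + 1) 0 (coface C M n i v))"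
      using cyclic_coface_first[of "coface C M n i v" "n + 1"] coface_MC_space[OF _ v] i by simp
    also have "\<dots> = cyclic_op C M (n + 2) (coface C M (n + 1) (i + 1) (coface C M n 0 v))"
      using coface_coface_inner[of 0 "i + 1" n v] i v by simp
    also have "\<dots> = coface C M (n + 1) i (cyclic_op C M (n + 1) (coface C M n 0 v))"
      using cyclic_coface[of "i + 1" "n + 1"] i d0 by simp
    also have "\<dots> = coface C M (n + 1) i (coface C M n (n + 1) v)"
      using cyclic_coface_first[OF v] by simp
    finally show ?thesis .
  qed
  have "coface C M (n + 1) (n + 2) (coface C M n (n + 1) v)
      = cyclic_op C M (n + 2) (coface C M (n + 1) 0 (coface C M n (n + 1) v))"
    using cyclic_coface_first[of "coface C M n (n + 1) v" "n + 1"] coface_MC_space[OF _ v] by simp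
  also have "\<dots> = cyclic_op C M (n + 2) (coface C M (n + 1) (n + 2) (coface C M n 0 v))"
    by (simp only: last[of 0, OF le0])
  also have "\<dots> = coface C M (n + 1) (n + 1) (cyclic_op C M (n + 1) (coface C M n 0 v))"
    using cyclic_coface[of "n + 2" "n + 1"] d0 by simp
  also have "\<dots> = coface C M (n + 1) (n + 1) (coface C M n (n + 1) v)"
    using cyclic_coface_first[OF v] by simp
  finally have top: "coface C M (n + 1) (n + 2) (coface C M n (n + 1) v)
    = coface C M (n + 1) (n + 1) (coface C M n (n + 1) v)" .
  consider "j \<le> n + 1" | "j = n + 2" "i \<le> n" | "j = n + 2" "i = n + 1"
    using assms by linarith
  then show ?thesis
    using last[of i] top coface_coface_inner[OF assms(1) _ v] by cases simp_all
qed

lemma codegeneracy_codegeneracy: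
  assumes "i \<le> j" "j \<le> n" and "(v :: ('m, 'c tpow) tensor) \<in> MC_space (n + 3)"
  shows "codegeneracy C (n + 1) j (codegeneracy C (n + 2) i v)
    = codegeneracy C (n + 1) i (codegeneracy C (n + 2) (j + 1) v)"
  using assms(3)
proof (rule MC_space_ext[rotated 2])
  have lin: "clinear (codegeneracy C (n + 1) j :: ('m, 'c tpow) tensor \<Rightarrow> _)"
     "clinear (codegeneracy C (n + 1) i :: ('m, 'c tpow) tensor \<Rightarrow> _)"
    using assms by (simp_all add: clinear_codegeneracy)
  show "clinear (\<lambda>v :: ('m, 'c tpow) tensor. codegeneracy C (n + 1) j (codegeneracy C (n + 2) i v))"
    "clinear (\<lambda>v :: ('m, 'c tpow) tensor. codegeneracy C (n + 1) i (codegeneracy C (n + 2)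
        (j + 1) v))"
    using assms by (intro clinear_compose[OF lin(1)] clinear_compose[OF lin(2)]
        clinear_codegeneracy; simp)+
  fix m :: 'm and cs :: "'c list"
  assume len: "length cs = n + 3"
  with assms have "i + 1 < j + 2" "j + 2 < length cs" by simp_all
  then obtain xs c ys d zs where cs: "cs = xs @ c # ys @ d # zs" "length xs = i + 1"
      "length ys = j + 2 - (i + 1) - 1"
    by (rule list_split_nth2)
  have "codegeneracy C (n + 1) j (codegeneracy C (n + 2) i (m \<otimes>\<^sub>C tp cs))
     = (counit C c * counit C d) *\<^sub>C (m \<otimes>\<^sub>C tp (xs @ ys @ zs))"
    using cs assms len codegeneracy_pure[of j "n + 1" "xs @ ys" zs m d]
    by (simp add: codegeneracy_pure clinear_scaleC[OF lin(1), simplified] scaleC_scaleC)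
  moreover have "codegeneracy C (n + 1) i (codegeneracy C (n + 2) (j + 1) (m \<otimes>\<^sub>C tp cs))
     = (counit C c * counit C d) *\<^sub>C (m \<otimes>\<^sub>C tp (xs @ ys @ zs))"
    using cs assms len codegeneracy_pure[of "j + 1" "n + 2" "xs @ c # ys" zs m d]
    by (simp add: codegeneracy_pure clinear_scaleC[OF lin(2), simplified] scaleC_scaleC
        mult.commute)
  ultimately show "codegeneracy C (n + 1) j (codegeneracy C (n + 2) i (m \<otimes>\<^sub>C tp cs))
    = codegeneracy C (n + 1) i (codegeneracy C (n + 2) (j + 1) (m \<otimes>\<^sub>C tp cs))" by simp
qed

lemma codegeneracy_coface_less:
  assumes "i < j" "j \<le> n" and "v \<in> MC_space (n + 1)"
  shows "codegeneracy C (n + 1) j (coface C M n i v)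
      = coface C M (n - 1) i (codegeneracy C n (j - 1) v)"
  using assms(3)
proof (rule MC_space_ext[rotated 2])
  have lin: "clinear (codegeneracy C (n + 1) j :: ('m, 'c tpow) tensor \<Rightarrow> _)"
     "clinear (coface C M (n - 1) i)"
    using assms by (simp_all add: clinear_codegeneracy clinear_coface)
  show "clinear (\<lambda>v. codegeneracy C (n + 1) j (coface C M n i v))"
    using assms by (intro clinear_compose[OF lin(1)] clinear_coface; simp)
  show "clinear (\<lambda>v. coface C M (n - 1) i (codegeneracy C n (j - 1) v))"
    using assms by (intro clinear_compose[OF lin(2)] clinear_codegeneracy; simp)
  fix m :: 'm and cs :: "'c list"
  assume len: "length cs = n + 1"
  with assms have "i < j" "j < length cs" by simp_all
  then obtain xs c ys d zs where cs: "cs = xs @ c # ys @ d # zs" "length xs = i"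
      "length ys = j - i - 1"
    by (rule list_split_nth2)
  have "codegeneracy C (n + 1) j (coface C M n i (m \<otimes>\<^sub>C tp cs))
     = tlift (\<lambda>c1 c2. counit C d *\<^sub>C (m \<otimes>\<^sub>C tp (xs @ c1 # c2 # ys @ zs))) (comult C c)"
    using cs assms len codegeneracy_pure[of j "n + 1" "xs @ c1 # c2 # ys" zs m d for c1 c2]
    by (simp add: coface_pure tlift_linear[OF lin(1), simplified])
  also have "\<dots> = counit C d *\<^sub>C tlift (\<lambda>c1 c2. m \<otimes>\<^sub>C tp (xs @ c1 # c2 # ys @ zs)) (comult C c)"
    by (rule tlift_linear[symmetric]) (intro clin)
  also have "\<dots> = coface C M (n - 1) i (codegeneracy C n (j - 1) (m \<otimes>\<^sub>C tp cs))"
    using cs assms len codegeneracy_pure[of "j - 1" n "xs @ c # ys" zs m d]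
    by (simp add: coface_pure clinear_scaleC[OF lin(2), simplified])
  finally show "codegeneracy C (n + 1) j (coface C M n i (m \<otimes>\<^sub>C tp cs))
    = coface C M (n - 1) i (codegeneracy C n (j - 1) (m \<otimes>\<^sub>C tp cs))" .
qed

lemma codegeneracy_coface_same:
  assumes "i = j \<or> i = j + 1" "j \<le> n" and "v \<in> MC_space (n + 1)"
  shows "codegeneracy C (n + 1) j (coface C M n i v) = v"
  using assms(3)
proof (rule MC_space_ext[rotated 2])
  have lin: "clinear (codegeneracy C (n + 1) j :: ('m, 'c tpow) tensor \<Rightarrow> _)"
    using assms by (simp add: clinear_codegeneracy)
  note push = tlift_linear[OF lin, simplified]
  show "clinear (\<lambda>v. codegeneracy C (n + 1) j (coface C M n i v))"
    using assms by (intro clinear_compose[OF lin] clinear_coface; auto)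
  show "clinear (\<lambda>v :: ('m, 'c tpow) tensor. v)" by (rule clin)
  fix m :: 'm and cs :: "'c list"
  assume len: "length cs = n + 1"
  show "codegeneracy C (n + 1) j (coface C M n i (m \<otimes>\<^sub>C tp cs)) = m \<otimes>\<^sub>C tp cs"
  proof (cases "i \<le> n")
    case True
    with len have "i < length cs" by simp
    then obtain xs c ys where cs: "cs = xs @ c # ys" "length xs = i"
      by (rule list_split_nth)
    have 1: "tlift (\<lambda>c1 c2. counit C c2 *\<^sub>C (m \<otimes>\<^sub>C tp (xs @ c1 # ys))) (comult C c)
        = m \<otimes>\<^sub>C tp (xs @ c # ys)"
      by (rule counit_right[OF coalgebra_C]) (intro clin)
    have 2: "tlift (\<lambda>c1 c2. counit C c1 *\<^sub>C (m \<otimes>\<^sub>C tp (xs @ c2 # ys))) (comult C c)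
        = m \<otimes>\<^sub>C tp (xs @ c # ys)"
      by (rule counit_left[OF coalgebra_C]) (intro clin)
    show ?thesis
      using assms(1)
    proof
      assume "i = j"
      then show ?thesis
        using cs len assms True codegeneracy_pure[of j "n + 1" "xs @ [c1]" ys m c2 for c1 c2] 1
        by (simp add: coface_pure push)
    next
      assume "i = j + 1"
      then show ?thesis
        using cs len assms True 2
        by (simp add: coface_pure push codegeneracy_pure)
    qed
  next
    case False
    with assms have [simp]: "i = n + 1" and jn [simp]: "j = n" by auto
    note push = tlift_linear[OF lin[unfolded jn], simplified]
    from len obtain c cs' where cs: "cs = c # cs'" and len': "length cs' = n"
      by (cases cs) auto
    have "codegeneracy C (n + 1) n (m0 \<otimes>\<^sub>C tp ((c2 # cs') @ [lact C x c1]))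
      = counit H x *\<^sub>C (counit C c1 *\<^sub>C (m0 \<otimes>\<^sub>C tp (c2 # cs')))" for m0 :: 'm and x c1 c2
      by (subst codegeneracy_pure) (simp_all add: len' counit_lact scaleC_scaleC)
    then have "codegeneracy C (n + 1) j (coface C M n i (m \<otimes>\<^sub>C tp cs))
      = tlift (\<lambda>x m0. tlift (\<lambda>c1 c2. counit H x *\<^sub>C (counit C c1 *\<^sub>C (m0 \<otimes>\<^sub>C tp (c2 # cs'))))
          (comult C c)) (coact M m)"
      using coface_last_pure[OF len'] by (simp add: cs push)
    also have "\<dots> = tlift (\<lambda>x m0. counit H x *\<^sub>C tlift (\<lambda>c1 c2. counit C c1 *\<^sub>C (m0 \<otimes>\<^sub>C tp
        (c2 # cs'))) (comult C c)) (coact M m)"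
      by (simp add: tlift_linear[OF clinear_scaleC_right[OF clinear_id]])
    also have "\<dots> = tlift (\<lambda>x m0. counit H x *\<^sub>C (m0 \<otimes>\<^sub>C tp (c # cs'))) (coact M m)"
    proof -
      have "tlift (\<lambda>c1 c2. counit C c1 *\<^sub>C (m0 \<otimes>\<^sub>C tp (c2 # cs'))) (comult C c)
          = m0 \<otimes>\<^sub>C tp (c # cs')" for m0 :: 'm
        by (rule counit_left[OF coalgebra_C]) (intro clin)
      then show ?thesis by simp
    qed
    also have "\<dots> = m \<otimes>\<^sub>C tp (c # cs')"
      by (rule coaction_counit) (intro clin)
    finally show ?thesis by (simp add: cs)
  qed
qed

text \<open>
  For the last coface, \<open>\<sigma>\<^sub>j \<tau> \<partial>\<^sub>0 = \<tau> \<sigma>\<^sub>j\<^sub>+\<^sub>1 \<partial>\<^sub>0 = \<tau> \<partial>\<^sub>0 \<sigma>\<^sub>j\<close>; an inner coface and a codegeneracy at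
  distant positions commute on pure tensors.
\<close>

lemma codegeneracy_coface_greater:
  assumes "j + 1 < i" "i \<le> n + 1" and v: "v \<in> MC_space (n + 1)"
  shows "codegeneracy C (n + 1) j (coface C M n i v)
      = coface C M (n - 1) (i - 1) (codegeneracy C n j v)"
proof (cases "i \<le> n")
  case False
  with assms have i: "i = n + 1" and j: "j < n" by auto
  \<comment> \<open>\<open>n \<ge> 1\<close> here, so that the coface after the codegeneracy is the last one in degree \<open>n - 1\<close>.\<close>
  define k where "k = n - 1"
  with j have n: "n = k + 1" by simp
  have "codegeneracy C (n + 1) j (coface C M n (n + 1) v)
      = codegeneracy C (n + 1) j (cyclic_op C M (n + 1) (coface C M n 0 v))"
    using cyclic_coface_first[OF v] by simp
  also have "\<dots> = cyclic_op C M n (codegeneracy C (n + 1) (j + 1) (coface C M n 0 v))"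
    using cyclic_codegeneracy[of "j + 1" n "coface C M n 0 v"] j coface_MC_space[OF _ v] by simp
  also have "\<dots> = cyclic_op C M n (coface C M (n - 1) 0 (codegeneracy C n j v))"
    using codegeneracy_coface_less[of 0 "j + 1" n v] j v by simp
  also have "\<dots> = coface C M (n - 1) n (codegeneracy C n j v)"
    using cyclic_coface_first[of "codegeneracy C n j v" k] codegeneracy_MC_space[OF j v] by
        (simp add: n)
  finally show ?thesis using i by simp
next
  case True
  from v show ?thesis
  proof (rule MC_space_ext[rotated 2])
    have lin: "clinear (codegeneracy C (n + 1) j :: ('m, 'c tpow) tensor \<Rightarrow> _)"
      "clinear (coface C M (n - 1) (i - 1))"
      using assms True by (simp_all add: clinear_codegeneracy clinear_coface)
    show "clinear (\<lambda>v. codegeneracy C (n + 1) j (coface C M n i v))"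
      using assms by (intro clinear_compose[OF lin(1)] clinear_coface; simp)
    show "clinear (\<lambda>v. coface C M (n - 1) (i - 1) (codegeneracy C n j v))"
      using assms True by (intro clinear_compose[OF lin(2)] clinear_codegeneracy; simp)
    fix m :: 'm and cs :: "'c list"
    assume len: "length cs = n + 1"
    with assms True have "j + 1 < i" "i < length cs" by simp_all
    then obtain xs d ys c zs where cs: "cs = xs @ d # ys @ c # zs" "length xs = j + 1"
        "length ys = i - (j + 1) - 1"
      by (rule list_split_nth2)
    have "codegeneracy C (n + 1) j (coface C M n i (m \<otimes>\<^sub>C tp cs))
       = tlift (\<lambda>c1 c2. counit C d *\<^sub>C (m \<otimes>\<^sub>C tp (xs @ ys @ c1 # c2 # zs))) (comult C c)"
      using cs assms True len coface_pure[of i n "xs @ d # ys" zs m c]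
      by (simp add: codegeneracy_pure tlift_linear[OF lin(1), simplified])
    also have "\<dots> = counit C d *\<^sub>C tlift (\<lambda>c1 c2. m \<otimes>\<^sub>C tp (xs @ ys @ c1 # c2 # zs)) (comult C c)"
      by (rule tlift_linear[symmetric]) (intro clin)
    also have "\<dots> = coface C M (n - 1) (i - 1) (codegeneracy C n j (m \<otimes>\<^sub>C tp cs))"
      using cs assms True len coface_pure[of "i - 1" "n - 1" "xs @ ys" zs m c]
      by (simp add: codegeneracy_pure clinear_scaleC[OF lin(2), simplified])
    finally show "codegeneracy C (n + 1) j (coface C M n i (m \<otimes>\<^sub>C tp cs))
      = coface C M (n - 1) (i - 1) (codegeneracy C n j (m \<otimes>\<^sub>C tp cs))" .
  qed
qed

end


section \<open>Passing to the quotient\<close>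

context hopf_coefficients
begin

lemma subspace_balanced: "complex_vector.subspace (balanced H C M N)"
  by (simp add: balanced_def)

lemma balanced_generator:
  assumes "length cs = N"
  shows "ract M m h \<otimes>\<^sub>C tp cs - diag_sum H C cs (\<lambda>ds. m \<otimes>\<^sub>C tp ds) h \<in> balanced H C M N"
proof -
  have "m \<otimes>\<^sub>C diag H C h (tp cs) = diag_sum H C cs (\<lambda>ds. m \<otimes>\<^sub>C tp ds) h"
    unfolding diag_tp by (rule diag_sum_linear) (intro clin)
  moreover have "tp cs \<in> tpow_space N"
    unfolding tpow_space_def using assms by (auto intro: complex_vector.span_base)
  ultimately show ?thesis
    unfolding balanced_def by (metis (mono_tags, lifting) complex_vector.span_base mem_Collect_eq)
qed

text \<open>
  It suffices to test generators \<open>mh \<otimes> d - m \<otimes> hd\<close> with \<open>d\<close> pure, since both terms are linear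
  in \<open>d\<close>; the linear map \<open>f\<close> moves into the sum defining \<open>hd\<close>.
\<close>

lemma balanced_image:
  assumes f: "clinear f" and v: "v \<in> balanced H C M N"
    and gen: "\<And>m h cs. length cs = N \<Longrightarrow>
      f (ract M m h \<otimes>\<^sub>C tp cs) - diag_sum H C cs (\<lambda>ds. f (m \<otimes>\<^sub>C tp ds)) h \<in> balanced H C M N'"
  shows "f v \<in> balanced H C M N'"
proof -
  have "f (ract M m h \<otimes>\<^sub>C d - m \<otimes>\<^sub>C diag H C h d) \<in> balanced H C M N'"
    if "d \<in> tpow_space N" for m h d
    using that[unfolded tpow_space_def] unfolding balanced_def
  proof (rule clinear_span[rotated 2])
    show "clinear (\<lambda>d. f (ract M m h \<otimes>\<^sub>C d - m \<otimes>\<^sub>C diag H C h d))"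
      by (rule clinearI) (simp_all add: clinear_simps[OF f] clinear_simps[OF clinear_diag]
          clinear_simps[OF clinear_tensor(2)[OF clinear_id]]
          complex_vector.scale_right_diff_distrib)
    fix x :: "'c tpow" assume "x \<in> {tp xs | xs. length xs = N}"
    then obtain cs where cs: "x = tp cs" "length cs = N" by auto
    have "clinear (\<lambda>d. f (m \<otimes>\<^sub>C d))"
      by (rule clinear_compose[OF f]) (intro clin)
    from diag_sum_linear[OF this, of H C cs tp h]
    have "f (m \<otimes>\<^sub>C diag H C h x) = diag_sum H C cs (\<lambda>ds. f (m \<otimes>\<^sub>C tp ds)) h"
      by (simp add: cs diag_tp)
    then show "f (ract M m h \<otimes>\<^sub>C x - m \<otimes>\<^sub>C diag H C h x) \<in> complex_vector.span
        {ract M m h \<otimes>\<^sub>C d - m \<otimes>\<^sub>C diag H C h d |m h d. d \<in> tpow_space N'}"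
      using gen[OF cs(2), of m h] by (simp add: clinear_minus[OF f] cs balanced_def)
  qed
  with v show ?thesis
    unfolding balanced_def by (elim clinear_span[OF f, rotated]) auto
qed

lemma tlift_minus_balanced:
  "(\<And>x y. f x y - g x y \<in> balanced H C M N) \<Longrightarrow> tlift f t - tlift g t \<in> balanced H C M N"
  unfolding tlift_minus balanced_def by (rule tlift_in_span)

lemma coface_inner_balanced:
  assumes "i \<le> n" and v: "v \<in> balanced H C M (n + 1)"
  shows "coface C M n i v \<in> balanced H C M (n + 2)"
proof (rule balanced_image[OF clinear_coface_inner[OF assms(1)] v])
  fix m :: 'm and h and cs :: "'c list"
  assume len: "length cs = n + 1"
  with assms have "i < length cs" by simp
  then obtain xs c ys where cs: "cs = xs @ c # ys" "length xs = i"
    by (rule list_split_nth)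
  with len assms have len': "i + length ys = n" by simp
  \<comment> \<open>\<open>?G\<close> is the coface on lists of length \<open>n + 1\<close>, but splits every list at position \<open>i\<close>, as \<open>diag_sum_comult\<close> requires.\<close>
  let ?F = "\<lambda>ds. m \<otimes>\<^sub>C tp ds" and ?G = "\<lambda>us. case drop i us of d # vs \<Rightarrow>
      tlift (\<lambda>d1 d2. m \<otimes>\<^sub>C tp (take i us @ d1 # d2 # vs)) (comult C d)"
  have "diag_sum H C cs (\<lambda>ds. coface C M n i (m \<otimes>\<^sub>C tp ds)) h = diag_sum H C cs ?G h"
  proof (rule diag_sum_cong)
    fix ds :: "'c list" assume ds: "length ds = length cs"
    with cs have "i < length ds" by simp
    then obtain us d vs where "ds = us @ d # vs" "length us = i"
      by (rule list_split_nth)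
    then show "coface C M n i (m \<otimes>\<^sub>C tp ds) = ?G ds"
      using assms(1) len' cs ds by (simp add: coface_pure)
  qed
  also have "\<dots> = tlift (\<lambda>c1 c2. diag_sum H C (xs @ c1 # c2 # ys) ?F h) (comult C c)"
    unfolding cs(1) by (rule diag_sum_comult[symmetric]) (intro multilinearI clin, simp add: cs)
  finally have eq: "diag_sum H C cs (\<lambda>ds. coface C M n i (m \<otimes>\<^sub>C tp ds)) h
    = tlift (\<lambda>c1 c2. diag_sum H C (xs @ c1 # c2 # ys) ?F h) (comult C c)" .
  have "tlift (\<lambda>c1 c2. ract M m h \<otimes>\<^sub>C tp (xs @ c1 # c2 # ys)) (comult C c)
    - tlift (\<lambda>c1 c2. diag_sum H C (xs @ c1 # c2 # ys) ?F h) (comult C c) \<in> balanced H C M (n + 2)"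
    by (intro tlift_minus_balanced balanced_generator) (use len' cs in simp)
  then show "coface C M n i (ract M m h \<otimes>\<^sub>C tp cs) - diag_sum H C cs (\<lambda>ds. coface C M n i
      (m \<otimes>\<^sub>C tp ds)) h
      \<in> balanced H C M (n + 2)"
    unfolding eq unfolding cs(1) using assms(1) cs(2) len' by (simp add: coface_pure)
qed

lemma codegeneracy_balanced:
  assumes "i < n" and v: "v \<in> balanced H C M (n + 1)"
  shows "codegeneracy C n i v \<in> balanced H C M n"
proof (rule balanced_image[OF clinear_codegeneracy[OF assms(1)] v])
  fix m :: 'm and h and cs :: "'c list"
  assume len: "length cs = n + 1"
  with assms have "i + 1 < length cs" by simp
  then obtain xs c ys where cs: "cs = xs @ c # ys" "length xs = i + 1"
    by (rule list_split_nth)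
  with len assms have len': "i + 1 + length ys = n" by simp
  \<comment> \<open>\<open>?G\<close> is the codegeneracy on lists of length \<open>n + 1\<close>, but splits every list at \<open>i + 1\<close>, as \<open>diag_sum_counit\<close> requires.\<close>
  let ?F = "\<lambda>ds. m \<otimes>\<^sub>C tp ds" and ?G = "\<lambda>us. case drop (i + 1) us of d # vs \<Rightarrow>
      counit C d *\<^sub>C (m \<otimes>\<^sub>C tp (take (i + 1) us @ vs))"
  have "diag_sum H C cs (\<lambda>ds. codegeneracy C n i (m \<otimes>\<^sub>C tp ds)) h = diag_sum H C cs ?G h"
  proof (rule diag_sum_cong)
    fix ds :: "'c list" assume ds: "length ds = length cs"
    with cs have "i + 1 < length ds" by simp
    then obtain us d vs where "ds = us @ d # vs" "length us = i + 1"
      by (rule list_split_nth)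
    then show "codegeneracy C n i (m \<otimes>\<^sub>C tp ds) = ?G ds"
      using assms(1) len' cs ds by (simp add: codegeneracy_pure)
  qed
  also have "\<dots> = counit C c *\<^sub>C diag_sum H C (xs @ ys) ?F h"
    unfolding cs(1) by (rule diag_sum_counit[symmetric]) (intro multilinearI clin, simp add: cs)
  finally have eq: "diag_sum H C cs (\<lambda>ds. codegeneracy C n i (m \<otimes>\<^sub>C tp ds)) h
    = counit C c *\<^sub>C diag_sum H C (xs @ ys) ?F h" .
  have "counit C c *\<^sub>C (ract M m h \<otimes>\<^sub>C tp (xs @ ys) - diag_sum H C (xs @ ys) ?F h) \<in> balanced H C M n"
    by (intro complex_vector.subspace_scale[OF subspace_balanced] balanced_generator) (use len' cs
        in simp)
  then show "codegeneracy C n i (ract M m h \<otimes>\<^sub>C tp cs) - diag_sum H C cs (\<lambda>ds. codegeneracy C n i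
      (m \<otimes>\<^sub>C tp ds)) h
      \<in> balanced H C M n"
    unfolding eq unfolding cs(1) using assms(1) cs(2) len'
    by (simp add: codegeneracy_pure complex_vector.scale_right_diff_distrib)
qed

end

locale sayd_coefficients = hopf_coefficients H C M
  for H :: "'h::complex_vector hopf"
    and C :: "('h, 'c::complex_vector) module_coalg"
    and M :: "('h, 'm::complex_vector) modcomod" +
  assumes AYD: "CH_AYD H C M"
    and stable: "CH_stable H C M"
begin

lemma AYD_coaction:
  assumes F: "cbilinear F"
  shows "tlift (\<lambda>x m0. F (lact C x c) m0) (coact M (ract M m h)) =
    tlift (\<lambda>h1 h'. tlift (\<lambda>h2 h3. tlift (\<lambda>x m0.
        F (lact C (antipode H h3) (lact C x (lact C h1 c))) (ract M m0 h2))
      (coact M m)) (comult H h')) (comult H h)"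
proof -
  have "tlift F (tlift (\<lambda>x m0. lact C x c \<otimes>\<^sub>C m0) (coact M (ract M m h))) =
    tlift F (tlift (\<lambda>h1 h'. tlift (\<lambda>h2 h3. tlift (\<lambda>x m0.
          lact C (times_of H (times_of H (antipode H h3) x) h1) c \<otimes>\<^sub>C ract M m0 h2)
        (coact M m)) (comult H h')) (comult H h))"
    using AYD by (simp add: CH_AYD_def)
  then show ?thesis
    by (simp add: tlift_tlift[OF F] tlift_tensor[OF F] lact_times)
qed

text \<open>
  The AYD condition turns \<open>\<tau>(mh \<otimes> c \<otimes> cs')\<close> into \<open>m\<^sub>0h\<^sup>(\<^sup>2\<^sup>) \<otimes> cs' \<otimes> S(h\<^sup>(\<^sup>3\<^sup>))m\<^sub>-\<^sub>1h\<^sup>(\<^sup>1\<^sup>)c\<close>. Modulo the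
  balanced subspace \<open>h\<^sup>(\<^sup>2\<^sup>)\<close> acts diagonally on the right, and its factor at the last entry
  cancels the antipode.
\<close>

lemma cyclic_op_balanced:
  assumes v: "v \<in> balanced H C M (n + 1)"
  shows "cyclic_op C M n v \<in> balanced H C M (n + 1)"
proof (rule balanced_image[OF clinear_cyclic_op v])
  fix m :: 'm and h and cs :: "'c list"
  assume "length cs = n + 1"
  then obtain c cs' where cs: "cs = c # cs'" and len: "length cs' = n"
    by (cases cs) auto
  \<comment> \<open>\<open>?d\<close> is the new last entry; in \<open>?G\<close> the antipode factor of it is replaced by a free argument \<open>e\<close>.\<close>
  let ?d = "\<lambda>h1 h3 x. lact C (antipode H h3) (lact C x (lact C h1 c))"
  let ?F = "\<lambda>m0 ds. m0 \<otimes>\<^sub>C tp ds"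
  let ?G = "\<lambda>h1 x m0 a e. diag_sum H C cs' (\<lambda>us. ?F m0 (us @ [lact C e (lact C x
      (lact C h1 c))])) a"
  let ?L = "\<lambda>f. tlift (\<lambda>h1 h'. tlift (\<lambda>h2 h3. tlift (\<lambda>x m0. f h1 h2 h3 x m0)
      (coact M m)) (comult H h')) (comult H h)"
  have L: "cyclic_op C M n (ract M m h \<otimes>\<^sub>C tp cs)
      = ?L (\<lambda>h1 h2 h3 x m0. ract M m0 h2 \<otimes>\<^sub>C tp (cs' @ [?d h1 h3 x]))"
    unfolding cs cyclic_op_pure[OF len] by (rule AYD_coaction) (intro clin)
  have bal: "?L (\<lambda>h1 h2 h3 x m0. ract M m0 h2 \<otimes>\<^sub>C tp (cs' @ [?d h1 h3 x]))
      - ?L (\<lambda>h1 h2 h3 x m0. diag_sum H C (cs' @ [?d h1 h3 x]) (?F m0) h2) \<in> balanced H C M (n + 1)"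
    by (intro tlift_minus_balanced balanced_generator) (simp add: len)
  have "?L (\<lambda>h1 h2 h3 x m0. diag_sum H C (cs' @ [?d h1 h3 x]) (?F m0) h2)
      = ?L (\<lambda>h1 h2 h3 x m0. tlift (\<lambda>a b. ?G h1 x m0 a (times_of H b (antipode H h3)))
          (comult H h2))"
  proof -
    have mult: "multilinear (?F m0)" for m0 :: 'm by (intro multilinearI clin)
    show ?thesis by (simp add: diag_sum_snoc[OF mult] lact_times)
  qed
  also have "\<dots> = tlift (\<lambda>h1 h'. tlift (\<lambda>x m0. tlift (\<lambda>h2 h3. tlift (\<lambda>a b.
      ?G h1 x m0 a (times_of H b (antipode H h3))) (comult H h2)) (comult H h')) (coact M m))
          (comult H h)"
    by (simp add: tlift_swap[of _ "coact M m"])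
  also have "\<dots> = tlift (\<lambda>h1 h'. tlift (\<lambda>x m0. ?G h1 x m0 h' (unit_of H)) (coact M m)) (comult H h)"
  proof -
    have "tlift (\<lambda>h2 h3. tlift (\<lambda>a b. ?G h1 x m0 a (times_of H b (antipode H h3))) (comult H h2))
        (comult H h')
        = ?G h1 x m0 h' (unit_of H)" for h1 h' x and m0 :: 'm
      by (rule antipode_cancel) (intro clin multilinearI)
    then show ?thesis by (simp only:)
  qed
  also have "\<dots> = diag_sum H C cs (\<lambda>ds. cyclic_op C M n (m \<otimes>\<^sub>C tp ds)) h"
  proof -
    have "tlift (\<lambda>x m0. ?G h1 x m0 h' (unit_of H)) (coact M m)
       = diag_sum H C cs' (\<lambda>ds. cyclic_op C M n (m \<otimes>\<^sub>C tp (lact C h1 c # ds))) h'" for h1 h'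
      unfolding tlift_diag_sum by (rule diag_sum_cong) (simp add: len cyclic_op_pure)
    then show ?thesis by (simp add: cs)
  qed
  finally show "cyclic_op C M n (ract M m h \<otimes>\<^sub>C tp cs)
      - diag_sum H C cs (\<lambda>ds. cyclic_op C M n (m \<otimes>\<^sub>C tp ds)) h \<in> balanced H C M (n + 1)"
    using bal by (simp only: L)
qed

text \<open>
  The last coface is \<open>\<tau> \<partial>\<^sub>0\<close>, and both factors preserve the balanced subspaces.
\<close>

lemma coface_balanced:
  assumes "i \<le> n + 1" and "v \<in> balanced H C M (n + 1)" and "v \<in> MC_space (n + 1)"
  shows "coface C M n i v \<in> balanced H C M (n + 2)"
proof (cases "i \<le> n")
  case True
  then show ?thesis using assms coface_inner_balanced by blast
next
  case False
  with assms(1) have "i = n + 1" by simp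
  then show ?thesis
    using cyclic_op_balanced[of "coface C M n 0 v" "n + 1"] coface_inner_balanced[of 0 n v] assms
      cyclic_coface_first[of v n] by simp
qed

lemma clinear_cyclic_op_funpow: "clinear (cyclic_op C M n ^^ k)"
  by (induction k) (auto simp: comp_def id_def intro: clin clinear_compose[OF clinear_cyclic_op])

text \<open>
  Each rotation lets one more leg of the iterated coaction act on the entry that is moved to
  the end. The legs are consumed from the left, in the order of the entries, so together they
  form the diagonal action of \<open>m\<^sub>-\<^sub>1\<close> on \<open>xs\<close>.
\<close>

lemma cyclic_op_iterate:
  "length (xs @ ys) = n + 1 \<Longrightarrow> (cyclic_op C M n ^^ length xs) (m \<otimes>\<^sub>C tp (xs @ ys)) =
    tlift (\<lambda>x m0. diag_sum H C xs (\<lambda>us. m0 \<otimes>\<^sub>C tp (ys @ us)) x) (coact M m)"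
proof (induction xs arbitrary: m ys)
  case Nil
  have "tlift (\<lambda>x m0. counit H x *\<^sub>C (m0 \<otimes>\<^sub>C tp ys)) (coact M m) = m \<otimes>\<^sub>C tp ys"
    by (rule coaction_counit) (intro clin)
  then show ?case by simp
next
  case (Cons c xs)
  note lin = clinear_cyclic_op_funpow
  let ?F = "\<lambda>x y m0. diag_sum H C xs (\<lambda>us. m0 \<otimes>\<^sub>C tp (ys @ lact C x c # us)) y"
  have "(cyclic_op C M n ^^ length (c # xs)) (m \<otimes>\<^sub>C tp ((c # xs) @ ys))
    = (cyclic_op C M n ^^ length xs) (cyclic_op C M n (m \<otimes>\<^sub>C tp (c # xs @ ys)))"
    by (simp add: funpow_swap1)
  also have "\<dots> = tlift (\<lambda>x m0. (cyclic_op C M n ^^ length xs) (m0 \<otimes>\<^sub>C tp (xs @ ys @ [lact C x c])))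
      (coact M m)"
    using Cons.prems by (simp add: cyclic_op_pure tlift_linear[OF lin])
  also have "\<dots> = tlift (\<lambda>x m0. tlift (\<lambda>y m1. ?F x y m1) (coact M m0)) (coact M m)"
    using Cons.prems by (simp add: Cons.IH)
  also have "\<dots> = tlift (\<lambda>x m0. tlift (\<lambda>x1 x2. ?F x1 x2 m0) (comult H x)) (coact M m)"
    by (rule coaction_coassociativity) (intro clin multilinearI)+
  finally show ?case by simp
qed

lemma cyclic_op_power:
  assumes v: "v \<in> MC_space (n + 1)"
  shows "(cyclic_op C M n ^^ (n + 1)) v - v \<in> balanced H C M (n + 1)"
proof -
  note lin = clinear_cyclic_op_funpow
  have lin': "clinear (\<lambda>v. (cyclic_op C M n ^^ (n + 1)) v - v)"
    by (rule clinearI) (simp_all only: clinear_simps[OF lin]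
        complex_vector.scale_right_diff_distrib, simp)
  from v show ?thesis
    unfolding MC_space_eq balanced_def
  proof (rule clinear_span[OF lin', rotated])
    fix w :: "('m, 'c tpow) tensor" assume "w \<in> {m \<otimes>\<^sub>C tp cs |m cs. length cs = n + 1}"
    then obtain m cs where w: "w = m \<otimes>\<^sub>C tp cs" and len: "length cs = n + 1" by auto
    have mem: "tp cs \<in> tpow_space (n + 1)"
      unfolding tpow_space_def using len by (auto intro: complex_vector.span_base)
    have "m0 \<otimes>\<^sub>C diag H C x (tp cs) = diag_sum H C cs (\<lambda>ds. m0 \<otimes>\<^sub>C tp ds) x" for m0 :: 'm and x
      unfolding diag_tp by (rule diag_sum_linear) (intro clin)
    then have "(cyclic_op C M n ^^ (n + 1)) w = tlift (\<lambda>x m0. m0 \<otimes>\<^sub>C diag H C x (tp cs)) (coact M m)"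
      using cyclic_op_iterate[of cs "[]" n m] len by (simp add: w)
    moreover have "coset (balanced H C M (n + 1)) \<dots> = coset (balanced H C M (n + 1)) w"
      using stable mem by (simp add: CH_stable_def w)
    ultimately show "(cyclic_op C M n ^^ (n + 1)) w - w \<in> complex_vector.span
        {ract M m h \<otimes>\<^sub>C d - m \<otimes>\<^sub>C diag H C h d |m h d. d \<in> tpow_space (n + 1)}"
      using coset_eq_iff[OF subspace_balanced] by (simp add: balanced_def)
  qed
qed

end


section \<open>The cocyclic module\<close>

context sayd_coefficients
begin

lemma subspace_MC_space: "complex_vector.subspace (MC_space N)"
  by (simp add: MC_space_def)

lemma balanced_subset_MC_space: "balanced H C M N \<subseteq> MC_space N"
  unfolding balanced_def
proof (intro complex_vector.span_minimal subsetI)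
  fix v assume "v \<in> {ract M m h \<otimes>\<^sub>C d - m \<otimes>\<^sub>C diag H C h d |m h d. d \<in> tpow_space N}"
  then obtain m h d where v: "v = ract M m h \<otimes>\<^sub>C d - m \<otimes>\<^sub>C diag H C h d" and d: "d \<in> tpow_space N"
    by auto
  have "diag H C h d \<in> tpow_space N"
    using d unfolding tpow_space_def
  proof (rule clinear_span[OF clinear_diag, rotated])
    fix t :: "'c tpow" assume "t \<in> {tp xs |xs. length xs = N}"
    then obtain cs where "t = tp cs" "length cs = N" by auto
    then show "diag H C h t \<in> complex_vector.span {tp xs |xs. length xs = N}"
      by (simp only: diag_tp) (intro diag_sum_in_span complex_vector.span_base, auto)
  qed
  with d show "v \<in> MC_space N"
    unfolding v MC_space_def by (intro complex_vector.span_diff complex_vector.span_base) auto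
qed (rule subspace_MC_space)

abbreviation quotient_class :: "nat \<Rightarrow> ('m, 'c tpow) tensor \<Rightarrow> ('m, 'c tpow) tensor set"
  where "quotient_class N \<equiv> coset (balanced H C M N)"

lemma induced_coface:
  "i \<le> n + 1 \<Longrightarrow> induced (balanced H C M (n + 2)) (coface C M n i) (quotient_class (n + 1) v)
    = quotient_class (n + 2) (coface C M n i v)"
  by (intro induced_coset clinear_coface subspace_balanced coface_balanced)
     (use balanced_subset_MC_space in auto)

lemma induced_codegeneracy:
  "i < n \<Longrightarrow> induced (balanced H C M n) (codegeneracy C n i) (quotient_class (n + 1) v)
    = quotient_class n (codegeneracy C n i v)"
  by (intro induced_coset clinear_codegeneracy subspace_balanced codegeneracy_balanced)

lemma induced_cyclic_op:
  "induced (balanced H C M (n + 1)) (cyclic_op C M n) (quotient_class (n + 1) v)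
    = quotient_class (n + 1) (cyclic_op C M n v)"
  by (intro induced_coset clinear_cyclic_op subspace_balanced cyclic_op_balanced)

lemma induced_cyclic_op_funpow:
  "(induced (balanced H C M (n + 1)) (cyclic_op C M n) ^^ k) (quotient_class (n + 1) v)
    = quotient_class (n + 1) ((cyclic_op C M n ^^ k) v)"
  by (induction k) (simp_all add: induced_cyclic_op[simplified])

lemma well_defined: "well_defined_ops H C M"
  unfolding well_defined_ops_def
  using balanced_subset_MC_space
  by (intro conjI allI impI descends_linear clinear_coface clinear_codegeneracy clinear_cyclic_op
      subspace_balanced coface_balanced codegeneracy_balanced cyclic_op_balanced
      coface_MC_space codegeneracy_MC_space cyclic_op_MC_space) auto

lemma carrier_tensor_over: "carrier (tensor_over H C M N) = quotient_class N ` MC_space N"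
  by (simp add: tensor_over_def quotient_space_simps[OF subspace_balanced])

lemma cosimplicial:
  "cosimplicial_module (ring_of_type_algebra :: complex ring)
      (\<lambda>n. tensor_over H C M (n + 1))
      (\<lambda>n i. induced (balanced H C M (n + 2)) (coface C M n i))
      (\<lambda>n i. induced (balanced H C M n) (codegeneracy C n i))"
proof (rule cosimplicial_module.intro)
  fix n i j :: nat and x
  show "Module.module (ring_of_type_algebra :: complex ring) (tensor_over H C M (n + 1))"
    unfolding tensor_over_def by (intro module_quotient_space subspace_MC_space subspace_balanced)
  show "module_map (ring_of_type_algebra :: complex ring) (tensor_over H C M (n + 1))
      (tensor_over H C M (n + 1 + 1)) (induced (balanced H C M (n + 2)) (coface C M n i))"
    if "i \<le> n + 1"
    unfolding tensor_over_def add.assoc one_add_one using that coface_balanced[OF that]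
        coface_MC_space[OF that]
      balanced_subset_MC_space[of "n + 1"]
    by (intro module_map_induced clinear_coface subspace_balanced) auto
  show "module_map (ring_of_type_algebra :: complex ring) (tensor_over H C M (n + 1))
      (tensor_over H C M (n - 1 + 1)) (induced (balanced H C M n) (codegeneracy C n i))"
    if "i < n"
  proof -
    have n: "n - 1 + 1 = n" using that by simp
    show ?thesis
      unfolding tensor_over_def n
      by (intro module_map_induced clinear_codegeneracy subspace_balanced codegeneracy_balanced
          codegeneracy_MC_space that)
  qed
  show "induced (balanced H C M (n + 1 + 2)) (coface C M (n + 1) j)
        (induced (balanced H C M (n + 2)) (coface C M n i) x) =
      induced (balanced H C M (n + 1 + 2)) (coface C M (n + 1) i)
        (induced (balanced H C M (n + 2)) (coface C M n (j - 1)) x)"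
    if "i < j" "j \<le> n + 2" "x \<in> carrier (tensor_over H C M (n + 1))"
  proof -
    from that obtain v where v: "v \<in> MC_space (n + 1)" "x = quotient_class (n + 1) v"
      by (auto simp: carrier_tensor_over)
    show ?thesis
      using that(1,2) coface_coface[OF that(1,2) v(1)] induced_coface[of _ "n + 1"]
        induced_coface[of _ n] by (simp add: v(2))
  qed
  show "induced (balanced H C M (n + 1)) (codegeneracy C (n + 1) j)
        (induced (balanced H C M (n + 2)) (codegeneracy C (n + 2) i) x) =
      induced (balanced H C M (n + 1)) (codegeneracy C (n + 1) i)
        (induced (balanced H C M (n + 2)) (codegeneracy C (n + 2) (j + 1)) x)"
    if "i \<le> j" "j \<le> n" "x \<in> carrier (tensor_over H C M (n + 2 + 1))"
  proof -
    from that obtain v where v: "v \<in> MC_space (n + 3)" "x = quotient_class (n + 3) v"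
      by (auto simp: carrier_tensor_over eval_nat_numeral)
    show ?thesis
      using that(1,2) codegeneracy_codegeneracy[OF that(1,2) v(1)] induced_codegeneracy[of _ "n +
          1"]
        induced_codegeneracy[of _ "n + 2"] by (simp add: v(2) eval_nat_numeral)
  qed
  show "induced (balanced H C M (n + 1)) (codegeneracy C (n + 1) j)
        (induced (balanced H C M (n + 2)) (coface C M n i) x) =
      induced (balanced H C M (n - 1 + 2)) (coface C M (n - 1) i)
        (induced (balanced H C M n) (codegeneracy C n (j - 1)) x)"
    if "i < j" "j \<le> n" "x \<in> carrier (tensor_over H C M (n + 1))"
  proof -
    from that obtain v where v: "v \<in> MC_space (n + 1)" "x = quotient_class (n + 1) v"
      by (auto simp: carrier_tensor_over)
    show ?thesis
      using that(1,2) codegeneracy_coface_less[OF that(1,2) v(1)] induced_codegeneracy[of j "n + 1"]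
        induced_codegeneracy[of "j - 1" n] induced_coface[of i n] induced_coface[of i "n - 1"]
      by (simp add: v(2))
  qed
  show "induced (balanced H C M (n + 1)) (codegeneracy C (n + 1) j)
        (induced (balanced H C M (n + 2)) (coface C M n i) x) = x"
    if "i = j \<or> i = j + 1" "j \<le> n" "x \<in> carrier (tensor_over H C M (n + 1))"
  proof -
    from that obtain v where v: "v \<in> MC_space (n + 1)" "x = quotient_class (n + 1) v"
      by (auto simp: carrier_tensor_over)
    from that have "i \<le> n + 1" by auto
    then show ?thesis
      using that(2) codegeneracy_coface_same[OF that(1,2) v(1)] induced_codegeneracy[of j "n + 1"]
        induced_coface[of i n]
      by (simp add: v(2))
  qed
  show "induced (balanced H C M (n + 1)) (codegeneracy C (n + 1) j)
        (induced (balanced H C M (n + 2)) (coface C M n i) x) =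
      induced (balanced H C M (n - 1 + 2)) (coface C M (n - 1) (i - 1))
        (induced (balanced H C M n) (codegeneracy C n j) x)"
    if "j + 1 < i" "i \<le> n + 1" "x \<in> carrier (tensor_over H C M (n + 1))"
  proof -
    from that obtain v where v: "v \<in> MC_space (n + 1)" "x = quotient_class (n + 1) v"
      by (auto simp: carrier_tensor_over)
    show ?thesis
      using that(1,2) codegeneracy_coface_greater[OF that(1,2) v(1)] induced_codegeneracy[of j "n
          + 1"]
        induced_codegeneracy[of j n] induced_coface[of i n] induced_coface[of "i - 1" "n - 1"]
      by (simp add: v(2))
  qed
qed

lemma cocyclic:
  "cocyclic_module (ring_of_type_algebra :: complex ring)
      (\<lambda>n. tensor_over H C M (n + 1))
      (\<lambda>n i. induced (balanced H C M (n + 2)) (coface C M n i))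
      (\<lambda>n i. induced (balanced H C M n) (codegeneracy C n i))
      (\<lambda>n. induced (balanced H C M (n + 1)) (cyclic_op C M n))"
proof (intro cocyclic_module.intro cosimplicial cocyclic_module_axioms.intro)
  fix n i :: nat and x
  show "module_map (ring_of_type_algebra :: complex ring) (tensor_over H C M (n + 1))
      (tensor_over H C M (n + 1)) (induced (balanced H C M (n + 1)) (cyclic_op C M n))"
    unfolding tensor_over_def
    by (intro module_map_induced clinear_cyclic_op subspace_balanced cyclic_op_balanced
        cyclic_op_MC_space)
  show "induced (balanced H C M (n + 1 + 1)) (cyclic_op C M (n + 1))
        (induced (balanced H C M (n + 2)) (coface C M n i) x) =
      induced (balanced H C M (n + 2)) (coface C M n (i - 1))
        (induced (balanced H C M (n + 1)) (cyclic_op C M n) x)"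
    if "1 \<le> i" "i \<le> n + 1" "x \<in> carrier (tensor_over H C M (n + 1))"
  proof -
    from that obtain v where v: "v \<in> MC_space (n + 1)" "x = quotient_class (n + 1) v"
      by (auto simp: carrier_tensor_over)
    show ?thesis
      using that(1,2) cyclic_coface[OF that(1,2) v(1)] induced_coface[of _ n]
        induced_cyclic_op[of "n + 1"] induced_cyclic_op[of n] by (simp add: v(2))
  qed
  show "induced (balanced H C M (n + 1 + 1)) (cyclic_op C M (n + 1))
        (induced (balanced H C M (n + 2)) (coface C M n 0) x) =
      induced (balanced H C M (n + 2)) (coface C M n (n + 1)) x"
    if "x \<in> carrier (tensor_over H C M (n + 1))"
  proof -
    from that obtain v where v: "v \<in> MC_space (n + 1)" "x = quotient_class (n + 1) v"
      by (auto simp: carrier_tensor_over)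
    show ?thesis
      using cyclic_coface_first[OF v(1)] induced_coface[of _ n]
        induced_cyclic_op[of "n + 1"] by (simp add: v(2))
  qed
  show "induced (balanced H C M (n + 1)) (cyclic_op C M n)
        (induced (balanced H C M (n + 1)) (codegeneracy C (n + 1) i) x) =
      induced (balanced H C M (n + 1)) (codegeneracy C (n + 1) (i - 1))
        (induced (balanced H C M (n + 1 + 1)) (cyclic_op C M (n + 1)) x)"
    if "1 \<le> i" "i \<le> n" "x \<in> carrier (tensor_over H C M (n + 1 + 1))"
  proof -
    from that obtain v where v: "v \<in> MC_space (n + 2)" "x = quotient_class (n + 2) v"
      by (auto simp: carrier_tensor_over)
    show ?thesis
      using that(1,2) cyclic_codegeneracy[OF that(1,2) v(1)] induced_codegeneracy[of _ "n + 1"]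
        induced_cyclic_op[of "n + 1"] induced_cyclic_op[of n] by (simp add: v(2))
  qed
  show "induced (balanced H C M (n + 1)) (cyclic_op C M n)
        (induced (balanced H C M (n + 1)) (codegeneracy C (n + 1) 0) x) =
      induced (balanced H C M (n + 1)) (codegeneracy C (n + 1) n)
        (induced (balanced H C M (n + 1 + 1)) (cyclic_op C M (n + 1))
          (induced (balanced H C M (n + 1 + 1)) (cyclic_op C M (n + 1)) x))"
    if "x \<in> carrier (tensor_over H C M (n + 1 + 1))"
  proof -
    from that obtain v where v: "v \<in> MC_space (n + 2)" "x = quotient_class (n + 2) v"
      by (auto simp: carrier_tensor_over)
    show ?thesis
      using cyclic_codegeneracy_first[OF v(1)] induced_codegeneracy[of _ "n + 1"]
        induced_cyclic_op[of "n + 1"] induced_cyclic_op[of n] by (simp add: v(2))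
  qed
  show "(induced (balanced H C M (n + 1)) (cyclic_op C M n) ^^ (n + 1)) x = x"
    if "x \<in> carrier (tensor_over H C M (n + 1))"
  proof -
    from that obtain v where v: "v \<in> MC_space (n + 1)" "x = quotient_class (n + 1) v"
      by (auto simp: carrier_tensor_over)
    show ?thesis
      unfolding v(2) induced_cyclic_op_funpow coset_eq_iff[OF subspace_balanced]
      by (rule cyclic_op_power[OF v(1)])
  qed
qed

end

theorem proposition2p6:
  fixes H :: "'h::complex_vector hopf"
    and C :: "('h, 'c::complex_vector) module_coalg"
    and M :: "('h, 'm::complex_vector) modcomod"
  assumes "hopf_algebra H" and "bij (antipode H)"
    and "left_module_coalgebra H C"
    and "CH_SAYD H C M"
  shows "CH_HCC H C M"
proof -
  interpret sayd_coefficients H C M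
    using assms by unfold_locales (simp_all add: CH_SAYD_def)
  show ?thesis
    unfolding CH_HCC_def using module_comodule well_defined cocyclic by blast
qed

end
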